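(* Let $q$ be a prime power and $G=\langle x,y\mid x^n=1=y^2,\ y^{-1}xy=x^s\rangle$, where $s^2\equiv1\pmod n$ and $\gcd(2n,q)=1$, and let $d=\gcd(n,s-1)$. Then the primitive central idempotents of $\mathbb F_qG$ are exactly the following: (1) for each irreducible divisor $f$ of $x^d-1$ in $\mathbb F_q[x]$, the two idempotents $\frac{1+y}{2}e_f(x)$ and $\frac{1-y}{2}e_f(x)$; (2) for each $s$-self-involutive irreducible factor $f$ of $\frac{x^n-1}{x^d-1}$, the idempotent $e_f(x)$; (3) for each pair $\{f,f^{*_s}\}$ of irreducible factors of $\frac{x^n-1}{x^d-1}$ with $f\neq f^{*_s}$ (i.e. $f$ not $s$-self-involutive), the idempotent $e_f(x)+e_{f^{*_s}}(x)$.
   Context: For a monic irreducible factor $f$ of $x^n-1$ in $\mathbb F_q[x]$, $e_f(x)=-\frac1n\,((f^* )')^*(x)\cdot\frac{x^n-1}{f(x)}$, viewed as an element of $\mathbb F_qG$ by substituting the group element $x$; here $g^*(x)=x^{\deg g}g(1/x)$ is the reciprocal polynomial, $'$ is the formal derivative, and the outer reciprocal of $(f^* )'$ is taken with respect to degree $\deg f-1$. (Equivalently, $e_f$ is the unique polynomial of degree $<n$ congruent to $1$ mod $f$ and to $0$ mod $(x^n-1)/f$.) For a monic $g(x)=(x-a_1)\cdots(x-a_k)$ with $g(0)\ne0$ and $s^2\equiv1\pmod{\mathrm{ord}(g)}$ (where $\mathrm{ord}(g)$ is the least $N\ge1$ with $g\mid x^N-1$), $g^{*_s}(x)=(x-a_1^s)\cdots(x-a_k^s)$,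 and $g$ is $s$-self-involutive if $g$ and $g^{*_s}$ have the same roots. *)

theory Defs
  imports
    "HOL-Algebra.Algebraic_Closure_Type"
    "HOL-Number_Theory.Cong"
    "HOL-Library.Cardinality"
begin

section \<open>Groups given by generators and relations\<close>

text \<open>
  Words over letters and their formal inverses: \<open>(a, False)\<close> stands for the generator \<open>a\<close>
  and \<open>(a, True)\<close> for its inverse.
\<close>

type_synonym 'x word = "('x \<times> bool) list"

definition word_power :: "'x \<Rightarrow> int \<Rightarrow> 'x word" where
  "word_power a k = replicate (nat \<bar>k\<bar>) (a, k < 0)"

inductive pres_eq :: "('x word \<times> 'x word) set \<Rightarrow> 'x word \<Rightarrow> 'x word \<Rightarrow> bool"
  for R :: "('x word \<times> 'x word) set" where
  pres_eq_relator: "(u, v) \<in> R \<Longrightarrow> pres_eq R u v"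
| pres_eq_cancel: "pres_eq R [(a, b), (a, \<not> b)] []"
| pres_eq_refl: "pres_eq R u u"
| pres_eq_sym: "pres_eq R u v \<Longrightarrow> pres_eq R v u"
| pres_eq_trans: "pres_eq R u v \<Longrightarrow> pres_eq R v w \<Longrightarrow> pres_eq R u w"
| pres_eq_append: "pres_eq R u u' \<Longrightarrow> pres_eq R v v' \<Longrightarrow> pres_eq R (u @ v) (u' @ v')"

definition pres_class :: "('x word \<times> 'x word) set \<Rightarrow> 'x word \<Rightarrow> 'x word set" where
  "pres_class R u = {v. pres_eq R u v}"

definition presented_group :: "('x word \<times> 'x word) set \<Rightarrow> 'x word set monoid" where
  "presented_group R =
    \<lparr>carrier = range (pres_class R),
     monoid.mult = (\<lambda>A B. \<Union>u\<in>A. \<Union>v\<in>B. pres_class R (u @ v)),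
     one = pres_class R []\<rparr>"

lemma pres_class_eq_iff: "pres_class R u = pres_class R v \<longleftrightarrow> pres_eq R u v"
  unfolding pres_class_def
  by (metis (no_types, lifting) Collect_cong mem_Collect_eq pres_eq_refl pres_eq_sym pres_eq_trans)

lemma presented_group_mult:
  "pres_class R u \<otimes>\<^bsub>presented_group R\<^esub> pres_class R v = pres_class R (u @ v)"
proof -
  have eq: "pres_class R (u' @ v') = pres_class R (u @ v)"
    if "u' \<in> pres_class R u" "v' \<in> pres_class R v" for u' v'
    unfolding pres_class_eq_iff
    by (rule pres_eq_sym, rule pres_eq_append) (use that in \<open>simp_all add: pres_class_def\<close>)
  have ne: "u \<in> pres_class R u" "v \<in> pres_class R v"
    by (simp_all add: pres_class_def pres_eq_refl)
  have "(\<Union>u'\<in>pres_class R u. \<Union>v'\<in>pres_class R v. pres_class R (u' @ v'))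
      = (\<Union>u'\<in>pres_class R u. \<Union>v'\<in>pres_class R v. pres_class R (u @ v))"
    by (simp add: eq)
  also have "\<dots> = pres_class R (u @ v)" using ne by blast
  finally show ?thesis by (simp add: presented_group_def)
qed

lemma pres_eq_inverse: "pres_eq R (rev (map (\<lambda>(a, b). (a, \<not> b)) u) @ u) []"
proof (induction u)
  case Nil
  show ?case by (simp add: pres_eq_refl)
next
  case (Cons l u)
  obtain a b where l: "l = (a, b)" by (cases l)
  let ?w = "rev (map (\<lambda>(a, b). (a, \<not> b)) u)"
  have "pres_eq R [(a, \<not> b), (a, b)] []" using pres_eq_cancel[of R a "\<not> b"] by simp
  hence "pres_eq R (?w @ ([(a, \<not> b), (a, b)] @ u)) (?w @ ([] @ u))"
    by (intro pres_eq_append pres_eq_refl)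
  hence "pres_eq R (?w @ ([(a, \<not> b), (a, b)] @ u)) []"
    using Cons.IH by (simp only: append_Nil) (rule pres_eq_trans)
  thus ?case by (simp add: l)
qed

lemma group_presented_group: "group (presented_group R)"
proof (rule groupI)
  fix A assume "A \<in> carrier (presented_group R)"
  then obtain u where u: "A = pres_class R u" by (auto simp: presented_group_def)
  let ?v = "rev (map (\<lambda>(a, b). (a, \<not> b)) u)"
  have "pres_class R ?v \<otimes>\<^bsub>presented_group R\<^esub> A = \<one>\<^bsub>presented_group R\<^esub>"
    unfolding u presented_group_mult
    by (simp add: presented_group_def pres_class_eq_iff pres_eq_inverse)
  thus "\<exists>B\<in>carrier (presented_group R). B \<otimes>\<^bsub>presented_group R\<^esub> A = \<one>\<^bsub>presented_group R\<^esub>"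
    by (intro bexI[of _ "pres_class R ?v"]) (auto simp: presented_group_def)
next
  show "\<one>\<^bsub>presented_group R\<^esub> \<in> carrier (presented_group R)"
    by (simp add: presented_group_def)
next
  fix A assume "A \<in> carrier (presented_group R)"
  then obtain u where u: "A = pres_class R u" by (auto simp: presented_group_def)
  have "\<one>\<^bsub>presented_group R\<^esub> = pres_class R []" by (simp add: presented_group_def)
  thus "\<one>\<^bsub>presented_group R\<^esub> \<otimes>\<^bsub>presented_group R\<^esub> A = A"
    by (simp add: u presented_group_mult)
next
  fix A B assume "A \<in> carrier (presented_group R)" "B \<in> carrier (presented_group R)"
  then obtain u v where "A = pres_class R u" "B = pres_class R v"
    by (auto simp: presented_group_def)
  thus "A \<otimes>\<^bsub>presented_group R\<^esub> B \<in> carrier (presented_group R)"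
    by (simp add: presented_group_mult) (simp add: presented_group_def)
next
  fix A B C assume "A \<in> carrier (presented_group R)" "B \<in> carrier (presented_group R)"
    "C \<in> carrier (presented_group R)"
  then obtain u v w where "A = pres_class R u" "B = pres_class R v" "C = pres_class R w"
    by (auto simp: presented_group_def)
  thus "A \<otimes>\<^bsub>presented_group R\<^esub> B \<otimes>\<^bsub>presented_group R\<^esub> C
      = A \<otimes>\<^bsub>presented_group R\<^esub> (B \<otimes>\<^bsub>presented_group R\<^esub> C)"
    by (simp add: presented_group_mult)
qed

datatype gen = Gen_x | Gen_y

definition metacyclic_relations :: "nat \<Rightarrow> int \<Rightarrow> (gen word \<times> gen word) set" where
  "metacyclic_relations n s =
    {(word_power Gen_x (int n), []),
     (word_power Gen_y 2, []),
     (word_power Gen_y (-1) @ word_power Gen_x 1 @ word_power Gen_y 1, word_power Gen_x s)}"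

definition metacyclic_group :: "nat \<Rightarrow> int \<Rightarrow> gen word set monoid" where
  "metacyclic_group n s = presented_group (metacyclic_relations n s)"

definition metacyclic_gen :: "nat \<Rightarrow> int \<Rightarrow> gen \<Rightarrow> gen word set" where
  "metacyclic_gen n s a = pres_class (metacyclic_relations n s) [(a, False)]"


section \<open>Group algebras and primitive central idempotents\<close>

definition group_algebra :: "('g, 'm) monoid_scheme \<Rightarrow> ('g \<Rightarrow> 'a::field) ring" where
  "group_algebra G =
    \<lparr>carrier = {a. finite {g. a g \<noteq> 0} \<and> {g. a g \<noteq> 0} \<subseteq> carrier G},
     monoid.mult = (\<lambda>a b g. \<Sum>(h, k) \<in> {(h, k). a h \<noteq> 0 \<and> b k \<noteq> 0 \<and> h \<otimes>\<^bsub>G\<^esub> k = g}. a h * b k),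
     one = (\<lambda>g. if g = \<one>\<^bsub>G\<^esub> then 1 else 0),
     zero = (\<lambda>g. 0),
     add = (\<lambda>a b g. a g + b g)\<rparr>"

lemma group_algebra_mult:
  assumes "finite S" "{g. a g \<noteq> 0} \<subseteq> S" "finite T" "{g. b g \<noteq> 0} \<subseteq> T"
  shows "(a \<otimes>\<^bsub>group_algebra G\<^esub> b) g =
    (\<Sum>h\<in>S. \<Sum>k\<in>T. if h \<otimes>\<^bsub>G\<^esub> k = g then a h * b k else (0 :: 'a::field))"
proof -
  have "(\<Sum>h\<in>S. \<Sum>k\<in>T. if h \<otimes>\<^bsub>G\<^esub> k = g then a h * b k else 0) =
      (\<Sum>(h, k)\<in>S \<times> T. if h \<otimes>\<^bsub>G\<^esub> k = g then a h * b k else 0)"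
    by (simp add: sum.cartesian_product)
  also have "\<dots> = (\<Sum>(h, k) \<in> {(h, k). a h \<noteq> 0 \<and> b k \<noteq> 0 \<and> h \<otimes>\<^bsub>G\<^esub> k = g}. a h * b k)"
    using assms by (intro sum.mono_neutral_cong_right) (auto split: if_splits)
  finally show ?thesis by (simp add: group_algebra_def)
qed

lemma group_algebra_support:
  assumes "a \<in> carrier (group_algebra G)"
  obtains "finite {g. a g \<noteq> 0}" "{g. a g \<noteq> 0} \<subseteq> carrier G"
  using assms by (simp add: group_algebra_def)

lemma ring_group_algebra:
  fixes G :: "('g, 'm) monoid_scheme" (structure)
  assumes "group G"
  shows "ring (group_algebra G :: ('g \<Rightarrow> 'a::field) ring)"
proof -
  interpret group G by fact
  let ?A = "group_algebra G :: ('g \<Rightarrow> 'a) ring"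
  have supp_mult: "{g. (a \<otimes>\<^bsub>?A\<^esub> b) g \<noteq> 0} \<subseteq> (\<lambda>(h, k). h \<otimes> k) ` ({g. a g \<noteq> 0} \<times> {g. b g \<noteq> 0})"
    for a b
  proof
    fix g assume "g \<in> {g. (a \<otimes>\<^bsub>?A\<^esub> b) g \<noteq> 0}"
    hence "(\<Sum>(h, k) \<in> {(h, k). a h \<noteq> 0 \<and> b k \<noteq> 0 \<and> h \<otimes> k = g}. a h * b k) \<noteq> 0"
      by (simp add: group_algebra_def)
    then obtain p where "p \<in> {(h, k). a h \<noteq> 0 \<and> b k \<noteq> 0 \<and> h \<otimes> k = g}"
      by (rule sum.not_neutral_contains_not_neutral)
    thus "g \<in> (\<lambda>(h, k). h \<otimes> k) ` ({g. a g \<noteq> 0} \<times> {g. b g \<noteq> 0})" by force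
  qed
  have closed: "a \<otimes>\<^bsub>?A\<^esub> b \<in> carrier ?A" if ab: "a \<in> carrier ?A" "b \<in> carrier ?A" for a b
  proof -
    have f: "finite {g. a g \<noteq> 0}" "{g. a g \<noteq> 0} \<subseteq> carrier G"
        "finite {g. b g \<noteq> 0}" "{g. b g \<noteq> 0} \<subseteq> carrier G"
      using ab by (simp_all add: group_algebra_def)
    have "finite {g. (a \<otimes>\<^bsub>?A\<^esub> b) g \<noteq> 0}"
      by (rule finite_subset[OF supp_mult]) (use f in simp)
    moreover have "{g. (a \<otimes>\<^bsub>?A\<^esub> b) g \<noteq> 0} \<subseteq> carrier G"
      by (rule order_trans[OF supp_mult]) (use f in auto)
    moreover have "c \<in> carrier ?A \<longleftrightarrow> finite {g. c g \<noteq> 0} \<and> {g. c g \<noteq> 0} \<subseteq> carrier G" for c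
      by (simp add: group_algebra_def)
    ultimately show ?thesis by blast
  qed
  have add: "(a \<oplus>\<^bsub>?A\<^esub> b) g = a g + b g" for a b g by (simp add: group_algebra_def)
  have add_closed: "a \<oplus>\<^bsub>?A\<^esub> b \<in> carrier ?A" if "a \<in> carrier ?A" "b \<in> carrier ?A" for a b
  proof -
    have "{g. a g + b g \<noteq> 0} \<subseteq> {g. a g \<noteq> 0} \<union> {g. b g \<noteq> 0}" by auto
    thus ?thesis using that
      by (auto simp: group_algebra_def intro: finite_subset)
  qed
  show ?thesis
  proof (rule ringI)
    show "abelian_group ?A"
    proof (rule abelian_groupI)
      fix a assume "a \<in> carrier ?A"
      thus "\<exists>b\<in>carrier ?A. b \<oplus>\<^bsub>?A\<^esub> a = \<zero>\<^bsub>?A\<^esub>"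
        by (intro bexI[of _ "\<lambda>g. - a g"]) (auto simp: group_algebra_def)
    qed (use add_closed in \<open>auto simp: group_algebra_def algebra_simps\<close>)
    show "Group.monoid ?A"
    proof (rule monoidI)
      show "\<one>\<^bsub>?A\<^esub> \<in> carrier ?A" by (simp add: group_algebra_def)
    next
      fix a b assume "a \<in> carrier ?A" "b \<in> carrier ?A"
      thus "a \<otimes>\<^bsub>?A\<^esub> b \<in> carrier ?A" by (rule closed)
    next
      fix a assume a: "a \<in> carrier ?A"
      then obtain f: "finite {g. a g \<noteq> 0}" "{g. a g \<noteq> 0} \<subseteq> carrier G" by (rule group_algebra_support)
      have one: "{g. \<one>\<^bsub>?A\<^esub> g \<noteq> 0} \<subseteq> {\<one>}" "\<one>\<^bsub>?A\<^esub> \<one> = 1" by (auto simp: group_algebra_def split: if_splits)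
      show "\<one>\<^bsub>?A\<^esub> \<otimes>\<^bsub>?A\<^esub> a = a"
      proof
        fix g
        have "(\<one>\<^bsub>?A\<^esub> \<otimes>\<^bsub>?A\<^esub> a) g = (\<Sum>k\<in>{g. a g \<noteq> 0}. if \<one> \<otimes> k = g then a k else 0)"
          by (subst group_algebra_mult[where S = "{\<one>}" and T = "{g. a g \<noteq> 0}"]) (use f one in \<open>auto intro!: sum.cong\<close>)
        also have "\<dots> = (\<Sum>k\<in>{g. a g \<noteq> 0}. if k = g then a k else 0)"
          using f(2) by (intro sum.cong) auto
        also have "\<dots> = a g" using f(1) by simp
        finally show "(\<one>\<^bsub>?A\<^esub> \<otimes>\<^bsub>?A\<^esub> a) g = a g" .
      qed
      show "a \<otimes>\<^bsub>?A\<^esub> \<one>\<^bsub>?A\<^esub> = a"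
      proof
        fix g
        have "(a \<otimes>\<^bsub>?A\<^esub> \<one>\<^bsub>?A\<^esub>) g = (\<Sum>k\<in>{g. a g \<noteq> 0}. if k \<otimes> \<one> = g then a k else 0)"
          by (subst group_algebra_mult[where T = "{\<one>}" and S = "{g. a g \<noteq> 0}"]) (use f one in \<open>auto intro!: sum.cong\<close>)
        also have "\<dots> = (\<Sum>k\<in>{g. a g \<noteq> 0}. if k = g then a k else 0)"
          using f(2) by (intro sum.cong) auto
        also have "\<dots> = a g" using f(1) by simp
        finally show "(a \<otimes>\<^bsub>?A\<^esub> \<one>\<^bsub>?A\<^esub>) g = a g" .
      qed
    next
      fix a b c assume abc: "a \<in> carrier ?A" "b \<in> carrier ?A" "c \<in> carrier ?A"
      define S T U where "S = {g. a g \<noteq> 0}" and "T = {g. b g \<noteq> 0}" and "U = {g. c g \<noteq> 0}"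
      have f: "finite S" "finite T" "finite U"
          "S \<subseteq> carrier G" "T \<subseteq> carrier G" "U \<subseteq> carrier G"
        using abc by (simp_all add: group_algebra_def S_def T_def U_def)
      define ST TU where "ST = (\<lambda>(h, k). h \<otimes> k) ` (S \<times> T)" and "TU = (\<lambda>(h, k). h \<otimes> k) ` (T \<times> U)"
      have f2: "finite ST" "finite TU" using f by (simp_all add: ST_def TU_def)
      have sub: "{g. (a \<otimes>\<^bsub>?A\<^esub> b) g \<noteq> 0} \<subseteq> ST" "{g. (b \<otimes>\<^bsub>?A\<^esub> c) g \<noteq> 0} \<subseteq> TU"
        using supp_mult unfolding ST_def TU_def S_def T_def U_def by blast+
      have ab: "(a \<otimes>\<^bsub>?A\<^esub> b) m = (\<Sum>h\<in>S. \<Sum>k\<in>T. if h \<otimes> k = m then a h * b k else 0)"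
        and bc: "(b \<otimes>\<^bsub>?A\<^esub> c) m = (\<Sum>k\<in>T. \<Sum>l\<in>U. if k \<otimes> l = m then b k * c l else 0)" for m
        by (rule group_algebra_mult; use f in \<open>simp add: S_def T_def U_def\<close>)+
      show "a \<otimes>\<^bsub>?A\<^esub> b \<otimes>\<^bsub>?A\<^esub> c = a \<otimes>\<^bsub>?A\<^esub> (b \<otimes>\<^bsub>?A\<^esub> c)"
      proof
        fix g
        have "(a \<otimes>\<^bsub>?A\<^esub> b \<otimes>\<^bsub>?A\<^esub> c) g
            = (\<Sum>m\<in>ST. \<Sum>l\<in>U. if m \<otimes> l = g then (a \<otimes>\<^bsub>?A\<^esub> b) m * c l else 0)"
          by (rule group_algebra_mult) (use f f2 sub in \<open>auto simp: U_def\<close>)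
        also have "\<dots> = (\<Sum>m\<in>ST. \<Sum>l\<in>U. \<Sum>h\<in>S. \<Sum>k\<in>T.
            if h \<otimes> k = m then if m \<otimes> l = g then a h * b k * c l else 0 else 0)"
          unfolding ab by (intro sum.cong refl) (simp add: sum_distrib_right cong: if_cong, intro impI sum.cong refl, simp)
        also have "\<dots> = (\<Sum>l\<in>U. \<Sum>h\<in>S. \<Sum>k\<in>T. \<Sum>m\<in>ST.
            if h \<otimes> k = m then if m \<otimes> l = g then a h * b k * c l else 0 else 0)"
          by (simp only: sum.swap[where A = ST])
        also have "\<dots> = (\<Sum>l\<in>U. \<Sum>h\<in>S. \<Sum>k\<in>T. if h \<otimes> k \<otimes> l = g then a h * b k * c l else 0)"
          using f2 by (intro sum.cong refl) (auto simp: ST_def)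
        also have "\<dots> = (\<Sum>h\<in>S. \<Sum>k\<in>T. \<Sum>l\<in>U. if h \<otimes> k \<otimes> l = g then a h * b k * c l else 0)"
          by (simp only: sum.swap[where A = U])
        also have "\<dots> = (\<Sum>h\<in>S. \<Sum>k\<in>T. \<Sum>l\<in>U. if h \<otimes> (k \<otimes> l) = g then a h * b k * c l else 0)"
          using f by (intro sum.cong refl) (auto simp: m_assoc subset_iff)
        also have "\<dots> = (\<Sum>h\<in>S. \<Sum>k\<in>T. \<Sum>l\<in>U. \<Sum>m\<in>TU.
            if k \<otimes> l = m then if h \<otimes> m = g then a h * b k * c l else 0 else 0)"
          using f2 by (intro sum.cong refl) (auto simp: TU_def)
        also have "\<dots> = (\<Sum>h\<in>S. \<Sum>m\<in>TU. \<Sum>k\<in>T. \<Sum>l\<in>U.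
            if k \<otimes> l = m then if h \<otimes> m = g then a h * b k * c l else 0 else 0)"
          by (rule sum.cong[OF refl]) (simp only: sum.swap[where B = TU])
        also have "\<dots> = (\<Sum>h\<in>S. \<Sum>m\<in>TU. if h \<otimes> m = g then a h * (b \<otimes>\<^bsub>?A\<^esub> c) m else 0)"
          unfolding bc by (intro sum.cong refl) (simp add: sum_distrib_left cong: if_cong, intro impI sum.cong refl, simp add: mult.assoc)
        also have "\<dots> = (a \<otimes>\<^bsub>?A\<^esub> (b \<otimes>\<^bsub>?A\<^esub> c)) g"
          by (rule group_algebra_mult[symmetric]) (use f f2 sub in \<open>auto simp: S_def\<close>)
        finally show "(a \<otimes>\<^bsub>?A\<^esub> b \<otimes>\<^bsub>?A\<^esub> c) g = (a \<otimes>\<^bsub>?A\<^esub> (b \<otimes>\<^bsub>?A\<^esub> c)) g" .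
      qed
    qed
  next
    fix a b c assume abc: "a \<in> carrier ?A" "b \<in> carrier ?A" "c \<in> carrier ?A"
    define U where "U = {g. a g \<noteq> 0} \<union> {g. b g \<noteq> 0} \<union> {g. c g \<noteq> 0}"
    have U: "finite U" using abc by (simp add: group_algebra_def U_def)
    have sub: "{g. a g \<noteq> 0} \<subseteq> U" "{g. b g \<noteq> 0} \<subseteq> U" "{g. c g \<noteq> 0} \<subseteq> U"
        "{g. (a \<oplus>\<^bsub>?A\<^esub> b) g \<noteq> 0} \<subseteq> U"
      by (auto simp: U_def add)
    note m = group_algebra_mult[OF U _ U, where G = G]
    show "(a \<oplus>\<^bsub>?A\<^esub> b) \<otimes>\<^bsub>?A\<^esub> c = a \<otimes>\<^bsub>?A\<^esub> c \<oplus>\<^bsub>?A\<^esub> b \<otimes>\<^bsub>?A\<^esub> c"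
      unfolding fun_eq_iff add m[OF sub(4,3)] m[OF sub(1,3)] m[OF sub(2,3)] sum.distrib[symmetric]
      by (intro allI sum.cong refl) (simp add: distrib_right)
    show "c \<otimes>\<^bsub>?A\<^esub> (a \<oplus>\<^bsub>?A\<^esub> b) = c \<otimes>\<^bsub>?A\<^esub> a \<oplus>\<^bsub>?A\<^esub> c \<otimes>\<^bsub>?A\<^esub> b"
      unfolding fun_eq_iff add m[OF sub(3,4)] m[OF sub(3,1)] m[OF sub(3,2)] sum.distrib[symmetric]
      by (intro allI sum.cong refl) (simp add: distrib_left)
  qed
qed

definition ga_single :: "'a::field \<Rightarrow> 'g \<Rightarrow> 'g \<Rightarrow> 'a" where
  "ga_single c g = (\<lambda>h. if h = g then c else 0)"

definition ga_subst :: "('g, 'm) monoid_scheme \<Rightarrow> 'g \<Rightarrow> 'a::field poly \<Rightarrow> 'g \<Rightarrow> 'a" where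
  "ga_subst G g p = (\<lambda>h. \<Sum>i\<le>Polynomial.degree p.
     ga_single (Polynomial.coeff p i) (g [^]\<^bsub>G\<^esub> i) h)"

definition central_idempotent :: "('r, 'm) ring_scheme \<Rightarrow> 'r \<Rightarrow> bool" where
  "central_idempotent R e \<longleftrightarrow>
     e \<in> carrier R \<and> e \<otimes>\<^bsub>R\<^esub> e = e \<and> (\<forall>a\<in>carrier R. a \<otimes>\<^bsub>R\<^esub> e = e \<otimes>\<^bsub>R\<^esub> a)"

definition primitive_central_idempotent :: "('r, 'm) ring_scheme \<Rightarrow> 'r \<Rightarrow> bool" where
  "primitive_central_idempotent R e \<longleftrightarrow>
     central_idempotent R e \<and> e \<noteq> \<zero>\<^bsub>R\<^esub> \<and>
     \<not> (\<exists>u v. central_idempotent R u \<and> central_idempotent R v \<and>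
              u \<noteq> \<zero>\<^bsub>R\<^esub> \<and> v \<noteq> \<zero>\<^bsub>R\<^esub> \<and> u \<otimes>\<^bsub>R\<^esub> v = \<zero>\<^bsub>R\<^esub> \<and> e = u \<oplus>\<^bsub>R\<^esub> v)"


section \<open>Polynomials\<close>

definition x_pow_minus_1 :: "nat \<Rightarrow> 'a::field poly" where
  "x_pow_minus_1 n = Polynomial.monom 1 n - 1"

definition monic_irreducible_factor :: "'a::field poly \<Rightarrow> 'a poly \<Rightarrow> bool" where
  "monic_irreducible_factor f p \<longleftrightarrow>
     Polynomial.lead_coeff f = 1 \<and> Factorial_Ring.irreducible f \<and> f dvd p"

text \<open>
  The reciprocal \<open>x\<^sup>m g(1/x)\<close> of \<open>g\<close> with respect to a degree \<open>m \<ge> deg g\<close>; for \<open>m = deg g\<close>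
  this is \<^const>\<open>reflect_poly\<close>.
\<close>

definition reciprocal_wrt :: "nat \<Rightarrow> 'a::field poly \<Rightarrow> 'a poly" where
  "reciprocal_wrt m g = (\<Sum>i\<le>m. Polynomial.monom (Polynomial.coeff g i) (m - i))"

definition e_poly :: "nat \<Rightarrow> 'a::field poly \<Rightarrow> 'a poly" where
  "e_poly n f =
     Polynomial.smult (- (1 / of_nat n))
       (reciprocal_wrt (Polynomial.degree f - 1) (Polynomial.pderiv (reflect_poly f)) *
        (x_pow_minus_1 n div f))"

definition poly_ord :: "'a::field poly \<Rightarrow> nat" where
  "poly_ord g = (LEAST N. N \<ge> 1 \<and> g dvd x_pow_minus_1 N)"

text \<open>
  The polynomial with roots \<open>a\<^sub>1\<^sup>s, \<dots>, a\<^sub>k\<^sup>s\<close>, first over the algebraic closure, where the roots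
  \<open>a\<^sub>1, \<dots>, a\<^sub>k\<close> of \<open>g\<close> (with multiplicity) live, and then over the base field. These are meant for
  monic \<open>g\<close> with \<open>g(0) \<noteq> 0\<close> and \<open>s\<^sup>2 \<equiv> 1\<close> modulo the order of \<open>g\<close>; divisors of \<open>x\<^sup>n - 1\<close>
  satisfy the last two conditions if \<open>s\<^sup>2 \<equiv> 1\<close> modulo \<open>n\<close>, see \<open>star_side_conditions\<close> below.
  Over a finite field the coefficients are fixed by Frobenius, hence lie in the base field.
\<close>

definition star_closure :: "int \<Rightarrow> 'a::field poly \<Rightarrow> 'a alg_closure poly" where
  "star_closure s g = (\<Prod>a\<in>#proots (map_poly to_ac g). [:- (a powi s), 1:])"

definition star :: "int \<Rightarrow> 'a::field poly \<Rightarrow> 'a poly" where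
  "star s g = map_poly of_ac (star_closure s g)"

definition self_involutive :: "int \<Rightarrow> 'a::field poly \<Rightarrow> bool" where
  "self_involutive s g \<longleftrightarrow>
     {a. poly (map_poly to_ac g) a = 0} = {a. poly (star_closure s g) a = 0}"

lemma star_side_conditions:
  fixes f :: "'a::field poly"
  assumes n: "n \<ge> 1" and f: "f dvd x_pow_minus_1 n" and s: "[s\<^sup>2 = 1] (mod int n)"
  shows "poly f 0 \<noteq> 0" "[s\<^sup>2 = 1] (mod int (poly_ord f))"
proof -
  show "poly f 0 \<noteq> 0"
  proof
    assume "poly f 0 = 0"
    with f have "poly (x_pow_minus_1 n :: 'a poly) 0 = 0" by (auto elim!: dvdE)
    with n show False by (simp add: x_pow_minus_1_def poly_monom power_0_left)
  qed
  define N where "N = poly_ord f"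
  have N: "N \<ge> 1 \<and> f dvd x_pow_minus_1 N"
    unfolding N_def poly_ord_def by (rule LeastI[of _ n]) (use n f in simp)
  have least: "N \<le> k" if "k \<ge> 1" "f dvd x_pow_minus_1 k" for k
    unfolding N_def poly_ord_def by (rule Least_le) (use that in simp)
  have add: "x_pow_minus_1 (i + j) = Polynomial.monom 1 j * x_pow_minus_1 i + (x_pow_minus_1 j :: 'a poly)" for i j
    by (simp add: x_pow_minus_1_def algebra_simps mult_monom)
  have mult: "f dvd x_pow_minus_1 (N * k)" for k
  proof (induction k)
    case (Suc k)
    show ?case using add[of N "N * k"] N Suc by simp
  qed (simp add: x_pow_minus_1_def one_pCons)
  have "x_pow_minus_1 n = Polynomial.monom 1 (n mod N) * x_pow_minus_1 (N * (n div N))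
      + (x_pow_minus_1 (n mod N) :: 'a poly)"
    using add[of "N * (n div N)" "n mod N"] by simp
  hence "f dvd x_pow_minus_1 (n mod N)"
    using f mult[of "n div N"] by (metis dvd_add_right_iff dvd_mult)
  moreover have "n mod N < N" using N by simp
  ultimately have "n mod N = 0" using least[of "n mod N"] by linarith
  hence "int N dvd int n" by auto
  thus "[s\<^sup>2 = 1] (mod int (poly_ord f))"
    using s unfolding N_def by (rule cong_dvd_modulus[rotated])
qed

end

theory Submission
  imports Defs "HOL-Number_Theory.Residues" "HOL-Computational_Algebra.Polynomial_Factorial"
begin

text \<open>
  Put \<open>M = X\<^sup>n - 1\<close> and choose a natural number \<open>t \<equiv> s\<close> modulo \<open>n\<close>. Every element of the group
  algebra is \<open>P(x) + Q(x) y\<close> with \<open>P\<close> and \<open>Q\<close> unique modulo \<open>M\<close>, and \<open>y P(x) = P(x\<^sup>t) y\<close>. Such an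
  element is a central idempotent iff, modulo \<open>M\<close>, \<open>P\<close> and \<open>Q\<close> are invariant under \<open>X \<mapsto> X\<^sup>t\<close>,
  \<open>Q (X\<^sup>t - X) = 0\<close>, \<open>P\<^sup>2 + Q\<^sup>2 = P\<close> and \<open>2PQ = Q\<close>. Modulo an irreducible factor \<open>f\<close> of \<open>M\<close> this says:
  if \<open>f\<close> divides \<open>X\<^sup>d - 1\<close>, then \<open>P + Q\<close> and \<open>P - Q\<close> are each 0 or 1; otherwise \<open>Q\<close> is 0 and \<open>P\<close> is
  0 or 1, with the same value at \<open>f\<close> and at its partner under \<open>X \<mapsto> X\<^sup>t\<close>. The listed elements are
  therefore nonzero central idempotents on which every central idempotent acts as 0 or 1, and no
  nonzero element is annihilated by all of them.

  The partner of \<open>f\<close> is the unique irreducible factor \<open>g\<close> of \<open>M\<close> dividing \<open>f(X\<^sup>t)\<close>. Comparing roots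
  in the algebraic closure shows that \<open>g\<close> is \<open>star s f\<close>; in particular its coefficients lie in the
  base field without any appeal to Frobenius.
\<close>

hide_const (open) UnivPoly.monom UnivPoly.coeff

section \<open>Polynomials over a field\<close>

lemma degree_pos_if_not_unit:
  fixes p :: "'a::field poly"
  assumes "p \<noteq> 0" "\<not> p dvd 1"
  shows "Polynomial.degree p > 0"
  using assms by (metis degree_eq_zeroE is_unit_const_poly_iff dvd_field_iff neq0_conv pCons_eq_0_iff one_neq_zero)

lemma irreducible_dvd_mult_poly:
  fixes h :: "'a::field poly"
  assumes "irreducible h" "h dvd p * q"
  shows "h dvd p \<or> h dvd q"
  using field_poly_irreducible_imp_prime[OF assms(1)] assms(2) by (simp add: prime_elem_dvd_mult_iff)

lemma irreducible_not_dvd_one_poly: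
  fixes h :: "'a::field poly"
  assumes "irreducible h"
  shows "\<not> h dvd 1"
  using assms by (simp add: irreducible_def)

lemma irreducible_dvd_dvd_one_diff:
  fixes h :: "'a::field poly"
  assumes "irreducible h" "h dvd p" "h dvd p - 1"
  shows False
proof -
  have "h dvd p - (p - 1)" using assms(2,3) by (rule dvd_diff)
  thus False using irreducible_not_dvd_one_poly[OF assms(1)] by simp
qed

lemma monic_irreducible_dvd_imp_eq:
  fixes f g :: "'a::field poly"
  assumes "irreducible f" "irreducible g" "lead_coeff f = 1" "lead_coeff g = 1" "f dvd g"
  shows "f = g"
proof -
  from assms(5) obtain k where k: "g = f * k" by (rule dvdE)
  have "k dvd 1" using assms(1,2) k by (auto simp: irreducible_def)
  then obtain c where c: "k = [:c:]" by (auto simp: is_unit_poly_iff)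
  have "c * lead_coeff f = lead_coeff g" unfolding k lead_coeff_mult by (simp add: c)
  with assms(3,4) have "c = 1" by simp
  with c k show ?thesis by (simp flip: one_pCons)
qed

text \<open>Induction on the degree: in a reducible \<open>p = a * b\<close> the nonunit
  \<open>b\<close> has positive degree, so the nonunit \<open>a\<close> has smaller degree than
  \<open>p\<close>.\<close>

lemma monic_irreducible_divisor_exists:
  fixes p :: "'a::field poly"
  assumes "p \<noteq> 0" "\<not> p dvd 1"
  shows "\<exists>h. lead_coeff h = 1 \<and> irreducible h \<and> h dvd p"
  using assms
proof (induction "Polynomial.degree p" arbitrary: p rule: less_induct)
  case less
  show ?case
  proof (cases "irreducible p")
    case True
    let ?h = "Polynomial.smult (inverse (lead_coeff p)) p"
    have nz: "lead_coeff p \<noteq> 0" using less.prems by simp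
    have "irreducible ([:inverse (lead_coeff p):] * p)"
      using True nz by (subst irreducible_mult_unit_left) (auto simp: is_unit_const_poly_iff dvd_field_iff)
    hence "irreducible ?h" by simp
    moreover have "lead_coeff ?h = 1" using nz by simp
    moreover have "?h dvd p" using nz by (simp add: smult_dvd_iff)
    ultimately show ?thesis by blast
  next
    case False
    then obtain a b where ab: "p = a * b" "\<not> a dvd 1" "\<not> b dvd 1"
      using less.prems by (auto simp: irreducible_def)
    have nz: "a \<noteq> 0" "b \<noteq> 0" using ab less.prems by auto
    have "Polynomial.degree b > 0"
      using nz(2) ab(3) by (rule degree_pos_if_not_unit)
    hence "Polynomial.degree a < Polynomial.degree p" using ab nz by (simp add: Polynomial.degree_mult_eq)
    from less.hyps[OF this nz(1) ab(2)] ab(1) show ?thesis by (meson dvd_mult2)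
  qed
qed

text \<open>The second hypothesis says that \<open>D\<close> is squarefree. Split off an irreducible
  factor, \<open>D = h * L\<close>; by induction \<open>P = L * P'\<close>, and the prime
  \<open>h\<close>, which does not divide \<open>L\<close>, must divide \<open>P'\<close>.\<close>

lemma dvd_if_irreducible_divisors_dvd:
  fixes D P :: "'a::field poly"
  assumes "D \<noteq> 0"
    and "\<And>h L. irreducible h \<Longrightarrow> D = h * L \<Longrightarrow> \<not> h dvd L"
    and "\<And>h. lead_coeff h = 1 \<Longrightarrow> irreducible h \<Longrightarrow> h dvd D \<Longrightarrow> h dvd P"
  shows "D dvd P"
  using assms
proof (induction "Polynomial.degree D" arbitrary: D rule: less_induct)
  case less
  show ?case
  proof (cases "D dvd 1")
    case False
    then obtain h where h: "lead_coeff h = 1" "irreducible h" "h dvd D"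
      using monic_irreducible_divisor_exists less.prems(1) by blast
    then obtain L where L: "D = h * L" by (auto elim: dvdE)
    have nz: "L \<noteq> 0" "h \<noteq> 0" using L less.prems(1) by auto
    have "Polynomial.degree h > 0"
      using nz(2) irreducible_not_dvd_one_poly[OF h(2)] by (rule degree_pos_if_not_unit)
    hence deg: "Polynomial.degree L < Polynomial.degree D" using L nz by (simp add: Polynomial.degree_mult_eq)
    have "L dvd P"
    proof (rule less.hyps[OF deg nz(1)])
      fix k K assume k: "irreducible k" "L = k * K"
      \<comment> \<open>\<open>h * K\<close> is the cofactor of \<open>k\<close> in
        \<open>D\<close>, so squarefreeness passes from \<open>D\<close> to
        \<open>L\<close>.\<close>
      have "\<not> k dvd h * K" by (rule less.prems(2)[OF k(1)]) (use k L in \<open>simp add: ac_simps\<close>)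
      thus "\<not> k dvd K" by (meson dvd_mult)
    next
      fix k assume "lead_coeff k = 1" "irreducible k" "k dvd L"
      thus "k dvd P" using less.prems(3) L by (meson dvd_mult)
    qed
    then obtain P' where P': "P = L * P'" by (rule dvdE)
    have "h dvd L * P'" using less.prems(3)[OF h] P' by simp
    moreover have "\<not> h dvd L" using less.prems(2)[OF h(2) L] .
    ultimately have "h dvd P'" using irreducible_dvd_mult_poly[OF h(2)] by blast
    thus ?thesis using L P' by (auto elim!: dvdE)
  qed (meson dvd_trans one_dvd)
qed

text \<open>The polynomial form of the rule that \<open>a - b\<close> divides
  \<open>P(a) - P(b)\<close>, by induction along Horner's scheme; \<open>[:0, 1:]\<close> is the
  variable X.\<close>

lemma pcompose_diff_dvd: "r - [:0, 1:] dvd pcompose P r - (P :: 'a::comm_ring_1 poly)"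
proof (induction P)
  case (pCons a P)
  have "pcompose (pCons a P) r - pCons a P
      = r * (pcompose P r - P) + (r - [:0, 1:]) * P"
    by (simp add: pcompose_pCons algebra_simps)
  thus ?case using pCons.IH by simp
qed simp

section \<open>The polynomials \<open>X\<^sup>n - 1\<close>\<close>

lemma x_pow_minus_1_add:
  "x_pow_minus_1 (i + j) = Polynomial.monom 1 j * x_pow_minus_1 i + (x_pow_minus_1 j :: 'a::field poly)"
  by (simp add: x_pow_minus_1_def algebra_simps mult_monom)

lemma x_pow_minus_1_0 [simp]: "x_pow_minus_1 0 = 0"
  by (simp add: x_pow_minus_1_def one_pCons monom_0)

lemma x_pow_minus_1_nonzero: "n > 0 \<Longrightarrow> x_pow_minus_1 n \<noteq> (0 :: 'a::field poly)"
  by (metis x_pow_minus_1_def Polynomial.degree_monom_eq eq_iff_diff_eq_0 degree_1 neq0_conv zero_neq_one)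

lemma x_pow_minus_1_dvd:
  assumes "m dvd k"
  shows "x_pow_minus_1 m dvd (x_pow_minus_1 k :: 'a::field poly)"
proof -
  have "x_pow_minus_1 m dvd (x_pow_minus_1 (m * j) :: 'a poly)" for j
  proof (induction j)
    case (Suc j)
    show ?case using x_pow_minus_1_add[of m "m * j", where 'a = 'a] Suc by simp
  qed simp
  thus ?thesis using assms by (auto elim!: dvdE)
qed

text \<open>A prime dividing a power of X divides X, hence X^n, and then also 1 = X^n - (X^n -
  1).\<close>

lemma irreducible_not_dvd_monom:
  fixes h :: "'a::field poly"
  assumes "irreducible h" "h dvd x_pow_minus_1 n" "n > 0"
  shows "\<not> h dvd Polynomial.monom 1 k"
proof
  have *: "Polynomial.monom 1 k = (Polynomial.monom 1 1 :: 'a poly) ^ k" for k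
    by (simp add: monom_power)
  assume "h dvd Polynomial.monom 1 k"
  hence "h dvd Polynomial.monom 1 1"
    using field_poly_irreducible_imp_prime[OF assms(1)] prime_elem_dvd_power *
    by metis
  hence "h dvd Polynomial.monom 1 n"
    using * assms(3) by (metis dvd_power dvd_trans)
  hence "h dvd Polynomial.monom 1 n - x_pow_minus_1 n" using assms(2) by (rule dvd_diff)
  thus False using irreducible_not_dvd_one_poly[OF assms(1)] by (simp add: x_pow_minus_1_def)
qed

text \<open>Bezout in the form \<open>n * a = k * b + gcd n k\<close>: subtracting a multiple of
  X^(k b) - 1 from X^(n a) - 1 leaves X^(gcd n k) - 1.\<close>

lemma dvd_x_pow_minus_1_gcd:
  fixes h :: "'a::field poly"
  assumes h: "irreducible h" "h dvd x_pow_minus_1 n" "n > 0" and "h dvd x_pow_minus_1 k"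
  shows "h dvd x_pow_minus_1 (gcd n k)"
proof -
  obtain a b where ab: "n * a = k * b + gcd n k"
    using bezout_nat[of n k] h(3) by auto
  have "h dvd x_pow_minus_1 (n * a)" "h dvd x_pow_minus_1 (k * b)"
    using x_pow_minus_1_dvd[of n "n * a"] x_pow_minus_1_dvd[of k "k * b"] assms
    by (meson dvd_trans dvd_triv_left)+
  thus ?thesis unfolding ab x_pow_minus_1_add
    by (metis dvd_add_right_iff dvd_mult)
qed

lemma pcompose_monom_x_pow_minus_1:
  "pcompose (x_pow_minus_1 m) (Polynomial.monom 1 t) = (x_pow_minus_1 (m * t) :: 'a::field poly)"
proof -
  have "pcompose (Polynomial.monom 1 m) (Polynomial.monom 1 t) = (Polynomial.monom 1 (m * t) :: 'a poly)"
    by (induction m) (simp_all add: monom_0 monom_Suc pcompose_pCons pcompose_1 mult_monom flip: one_pCons)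
  thus ?thesis by (simp add: x_pow_minus_1_def pcompose_diff pcompose_1)
qed

text \<open>The factor X raises the exponent \<open>n - 1\<close> to \<open>n\<close> and so avoids
  truncated subtraction.\<close>

lemma x_pow_minus_1_pderiv:
  "[:0, 1:] * pderiv (x_pow_minus_1 n) = Polynomial.smult (of_nat n) (Polynomial.monom 1 n :: 'a::field poly)"
  by (cases n) (simp_all add: x_pow_minus_1_def pderiv_diff pderiv_monom pderiv_1 smult_monom flip: monom_Suc)

text \<open>A repeated factor would divide the derivative and hence n X^n; but n is invertible, and
  an irreducible factor of X^n - 1 divides no power of X.\<close>

lemma x_pow_minus_1_squarefree:
  fixes h L :: "'a::field poly"
  assumes "of_nat n \<noteq> (0::'a)" "irreducible h" "x_pow_minus_1 n = h * L"
  shows "\<not> h dvd L"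
proof
  assume "h dvd L"
  have n: "n > 0" using assms(1) by (cases n) auto
  have "pderiv (x_pow_minus_1 n) = h * pderiv L + L * pderiv h"
    using assms(3) by (simp add: pderiv_mult ac_simps)
  hence "h dvd pderiv (x_pow_minus_1 n)" using \<open>h dvd L\<close> by simp
  hence "h dvd [:0, 1:] * pderiv (x_pow_minus_1 n)" by (rule dvd_mult)
  hence "h dvd Polynomial.monom 1 n"
    unfolding x_pow_minus_1_pderiv using assms(1) by (simp add: dvd_smult_iff)
  thus False using irreducible_not_dvd_monom[OF assms(2) _ n] assms(3) by auto
qed

section \<open>The polynomials \<open>e\<^sub>f\<close>\<close>

text \<open>With m = deg f, the derivative of the reciprocal has at \<open>m - 1 - k\<close> the
  coefficient of \<open>f\<close> at \<open>k\<close> times m - k, and reversal with respect to m -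
  1 puts it back at \<open>k\<close>. The right-hand side is free of reciprocals and fits the
  product rule.\<close>

lemma reciprocal_wrt_pderiv_reflect_poly:
  fixes f :: "'a::field poly"
  assumes "Polynomial.degree f > 0"
  shows "reciprocal_wrt (Polynomial.degree f - 1) (pderiv (reflect_poly f))
    = Polynomial.smult (of_nat (Polynomial.degree f)) f - [:0, 1:] * pderiv f"
proof (rule poly_eqI)
  fix k
  let ?m = "Polynomial.degree f"
  have "coeff (reciprocal_wrt (?m - 1) (pderiv (reflect_poly f))) k
      = (\<Sum>i\<le>?m - 1. if ?m - 1 - i = k then coeff (pderiv (reflect_poly f)) i else 0)"
    by (simp add: reciprocal_wrt_def Polynomial.coeff_sum)
  also have "\<dots> = (if k \<le> ?m - 1 then coeff (pderiv (reflect_poly f)) (?m - 1 - k) else 0)"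
  proof (cases "k \<le> ?m - 1")
    case True
    have "(\<Sum>i\<le>?m - 1. if ?m - 1 - i = k then coeff (pderiv (reflect_poly f)) i else 0)
      = (\<Sum>i\<le>?m - 1. if i = ?m - 1 - k then coeff (pderiv (reflect_poly f)) i else 0)"
      using True assms by (intro sum.cong refl) (metis (no_types) atMost_iff diff_diff_cancel)
    thus ?thesis using True by simp
  qed (auto intro!: sum.neutral)
  also have "\<dots> = of_nat (?m - k) * coeff f k"
  proof (cases "k \<le> ?m - 1")
    case True
    hence "Suc (?m - 1 - k) = ?m - k" "?m - (?m - k) = k" using assms by auto
    thus ?thesis using True by (simp add: coeff_pderiv coeff_reflect_poly del: of_nat_diff of_nat_Suc)
  next
    case False
    hence "?m - k = 0" by auto
    thus ?thesis using False by simp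
  qed
  \<comment> \<open>For \<open>k > ?m\<close> the truncated difference is 0 and the field difference
    may not be, but the coefficient of \<open>f\<close> vanishes there.\<close>
  also have "\<dots> = (of_nat ?m - of_nat k) * coeff f k"
    by (cases "k \<le> ?m") (auto simp: of_nat_diff coeff_eq_0)
  also have "\<dots> = coeff (Polynomial.smult (of_nat ?m) f - [:0, 1:] * pderiv f) k"
    by (cases k) (simp_all add: coeff_pderiv algebra_simps)
  finally show "coeff (reciprocal_wrt (?m - 1) (pderiv (reflect_poly f))) k = \<dots>" .
qed

text \<open>Let m = deg f. The product rule for X^n - 1 = f K, multiplied by X, shows that X K f' is
  congruent to n modulo f. Since e_f = -(1/n) (m f - X f') K, it is congruent to 1 modulo f, and K
  is a visible factor.\<close>

lemma e_poly_cong: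
  fixes f K :: "'a::field poly"
  assumes n: "of_nat n \<noteq> (0::'a)" and f: "irreducible f" and K: "x_pow_minus_1 n = f * K"
  shows "K dvd e_poly n f" "f dvd e_poly n f - 1"
proof -
  have fnz: "f \<noteq> 0" using f by auto
  have "Polynomial.degree f > 0"
    using fnz irreducible_not_dvd_one_poly[OF f] by (rule degree_pos_if_not_unit)
  moreover have "x_pow_minus_1 n div f = K" using K fnz by simp
  ultimately have e: "e_poly n f = Polynomial.smult (- (1 / of_nat n))
      ((Polynomial.smult (of_nat (Polynomial.degree f)) f - [:0, 1:] * pderiv f) * K)"
    by (simp only: e_poly_def reciprocal_wrt_pderiv_reflect_poly)
  show "K dvd e_poly n f" unfolding e by (intro dvd_smult dvd_triv_right)
  have "[:0, 1:] * (f * pderiv K + K * pderiv f) = Polynomial.smult (of_nat n) (f * K + 1)"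
  proof -
    have "pderiv (x_pow_minus_1 n) = f * pderiv K + K * pderiv f"
      by (simp only: K pderiv_mult)
    moreover have "Polynomial.monom 1 n = f * K + 1"
      using K by (simp add: x_pow_minus_1_def algebra_simps)
    ultimately show ?thesis using x_pow_minus_1_pderiv[where n = n and 'a = 'a] by simp
  qed
  hence *: "[:0, 1:] * (K * pderiv f)
      = Polynomial.smult (of_nat n) (f * K + 1) - [:0, 1:] * (f * pderiv K)"
    by (simp only: distrib_left) (metis add_diff_cancel_left')
  have "Polynomial.smult (of_nat n) (e_poly n f - 1)
      = - ((Polynomial.smult (of_nat (Polynomial.degree f)) f - [:0, 1:] * pderiv f) * K)
        - Polynomial.smult (of_nat n) 1"
    unfolding e smult_diff_right smult_smult using n by simp
  also have "\<dots> = [:0, 1:] * (K * pderiv f)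
      - Polynomial.smult (of_nat (Polynomial.degree f)) (f * K) - Polynomial.smult (of_nat n) 1"
    by (simp add: algebra_simps)
  also have "\<dots> = f * (Polynomial.smult (of_nat n) K - [:0, 1:] * pderiv K
      - Polynomial.smult (of_nat (Polynomial.degree f)) K)"
    unfolding * by (simp only: smult_add_right right_diff_distrib mult_smult_right mult.left_commute[of f])
      (simp only: algebra_simps)
  finally have "f dvd Polynomial.smult (of_nat n) (e_poly n f - 1)" by simp
  thus "f dvd e_poly n f - 1" using n by (simp add: dvd_smult_iff)
qed

section \<open>The substitution \<open>X \<mapsto> X\<^sup>t\<close> modulo \<open>X\<^sup>n - 1\<close>\<close>

text \<open>The positive natural number \<open>t\<close> stands for \<open>s\<close> modulo
  \<open>n\<close>, so that X^t is a polynomial. \<open>t_square\<close> makes the substitution an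
  involution modulo \<open>M\<close>, and \<open>of_nat_n\<close> makes \<open>M\<close>
  squarefree.\<close>

locale power_twist =
  fixes n t :: nat and M :: "'a::field poly"
  assumes M_eq: "M = x_pow_minus_1 n"
    and of_nat_n: "of_nat n \<noteq> (0::'a)"
    and t_pos: "t > 0"
    and t_square: "[t * t = 1] (mod n)"
begin

text \<open>On polynomials in \<open>x\<close> this is conjugation by \<open>y\<close> in the group
  algebra.\<close>

definition twist :: "'a poly \<Rightarrow> 'a poly" where
  "twist P = pcompose P (Polynomial.monom 1 t)"

abbreviation irr :: "'a poly \<Rightarrow> bool" where
  "irr f \<equiv> monic_irreducible_factor f M"

lemma n_gt_0: "n > 0"
  using of_nat_n by (cases n) auto

lemma twist_simps [simp]:
  "twist (P + Q) = twist P + twist Q" "twist (P - Q) = twist P - twist Q"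
  "twist (P * Q) = twist P * twist Q" "twist (Polynomial.smult c P) = Polynomial.smult c (twist P)"
  "twist (- P) = - twist P" "twist 1 = 1" "twist 0 = 0" "twist [:c:] = [:c:]"
  "twist [:0, 1:] = Polynomial.monom 1 t"
  by (simp_all add: twist_def pcompose_add pcompose_diff pcompose_mult pcompose_smult pcompose_uminus
      pcompose_1 pcompose_pCons)

lemma twist_dvd: "P dvd Q \<Longrightarrow> twist P dvd twist Q"
  by (auto elim!: dvdE)

text \<open>M(X^t) = X^(n t) - 1 is a multiple of \<open>M\<close>, so the substitution is well
  defined modulo \<open>M\<close>.\<close>

lemma M_dvd_twist: "M dvd P \<Longrightarrow> M dvd twist P"
  using twist_dvd[of M P] x_pow_minus_1_dvd[of n "n * t", where 'a = 'a]
  by (auto simp: M_eq twist_def pcompose_monom_x_pow_minus_1 intro: dvd_trans)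

lemma t_square_eq: obtains k where "t * t = Suc (n * k)"
proof -
  have "t * t \<ge> 1" using t_pos by (simp add: Suc_le_eq)
  with t_square have "n dvd t * t - 1" by (simp add: cong_altdef_nat)
  then obtain k where "t * t - 1 = n * k" by (rule dvdE)
  with \<open>t * t \<ge> 1\<close> have "t * t = Suc (n * k)" by linarith
  thus thesis by (rule that)
qed

text \<open>The double substitution sends X to X^(t t), and X^(t t) - X = X (X^(n k) - 1) is a
  multiple of \<open>M\<close>.\<close>

lemma twist_twist: "M dvd twist (twist P) - P"
proof -
  obtain k where k: "t * t = Suc (n * k)" by (rule t_square_eq)
  have "pcompose (Polynomial.monom 1 t) (Polynomial.monom 1 t)
      = (Polynomial.monom 1 (t * t) :: 'a poly)"
    using pcompose_monom_x_pow_minus_1[of t t, where 'a = 'a]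
    by (simp add: x_pow_minus_1_def pcompose_diff pcompose_1)
  hence "twist (twist P) = pcompose P (Polynomial.monom 1 (t * t))"
    by (simp add: twist_def flip: pcompose_assoc)
  moreover have "Polynomial.monom 1 (t * t) - [:0, 1:] = [:0, 1:] * (x_pow_minus_1 (n * k) :: 'a poly)"
    by (simp add: k x_pow_minus_1_def monom_Suc algebra_simps)
  ultimately show ?thesis
    using pcompose_diff_dvd[of "Polynomial.monom 1 (t * t)" P] x_pow_minus_1_dvd[of n "n * k", where 'a = 'a]
    unfolding M_eq by (metis dvd_mult dvd_trans dvd_triv_left)
qed

text \<open>Modulo every divisor of X^t - X the substitution is the identity; this is what singles
  out the factors of X^d - 1.\<close>

lemma twist_diff_dvd: "Polynomial.monom 1 t - [:0, 1:] dvd twist P - P"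
  unfolding twist_def by (rule pcompose_diff_dvd)

lemma irrD:
  assumes "irr f"
  shows "irreducible f" "lead_coeff f = 1" "f dvd M" "\<not> f dvd 1"
  using assms irreducible_not_dvd_one_poly by (auto simp: monic_irreducible_factor_def)

lemma irr_cofactor:
  assumes "irr f"
  obtains K where "M = f * K" "\<not> f dvd K"
  using irrD[OF assms] x_pow_minus_1_squarefree[OF of_nat_n] M_eq by (metis dvdE)

lemma irr_dvd_mult: "irr h \<Longrightarrow> h dvd P * Q \<Longrightarrow> h dvd P \<or> h dvd Q"
  using irrD(1) irreducible_dvd_mult_poly by blast

lemma irr_dvd_imp_eq: "irr f \<Longrightarrow> irr g \<Longrightarrow> f dvd g \<Longrightarrow> f = g"
  using monic_irreducible_dvd_imp_eq irrD by blast

text \<open>\<open>M\<close> is squarefree, so congruences modulo \<open>M\<close> can be checked at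
  one irreducible factor at a time.\<close>

lemma M_dvd_if: "(\<And>h. irr h \<Longrightarrow> h dvd P) \<Longrightarrow> M dvd P"
  by (rule dvd_if_irreducible_divisors_dvd)
    (auto simp: M_eq monic_irreducible_factor_def x_pow_minus_1_nonzero n_gt_0
        x_pow_minus_1_squarefree[OF of_nat_n])

section \<open>Partners of irreducible factors under the substitution\<close>

lemma dvd_of_dvd_twist_twist:
  assumes "irr h" "h dvd twist (twist P)"
  shows "h dvd P"
proof -
  have "h dvd twist (twist P) - P" using irrD(3)[OF assms(1)] twist_twist dvd_trans by blast
  with assms(2) have "h dvd twist (twist P) - (twist (twist P) - P)" by (rule dvd_diff)
  thus ?thesis by simp
qed

text \<open>\<open>f\<close> divides \<open>M\<close>, hence also
  \<open>twist M = twist h * twist L\<close>, and \<open>f\<close> is prime.\<close>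

lemma dvd_twist_cofactor:
  assumes "irr f" "M = h * L" "\<not> f dvd twist h"
  shows "f dvd twist L"
proof -
  have "f dvd twist (h * L)"
    using assms(1,2) irrD(3) M_dvd_twist[of M] by (metis dvd_refl dvd_trans)
  thus ?thesis using irr_dvd_mult[OF assms(1)] assms(3) by auto
qed

text \<open>Otherwise \<open>f\<close> divides \<open>twist L\<close> for the cofactor
  \<open>L\<close> of \<open>h\<close>. Then \<open>h\<close>, dividing \<open>twist f\<close>,
  divides \<open>twist (twist L)\<close> and so \<open>L\<close>, against squarefreeness.\<close>

lemma dvd_twist_sym:
  assumes "irr f" "irr h" "h dvd twist f"
  shows "f dvd twist h"
proof (rule ccontr)
  assume *: "\<not> f dvd twist h"
  obtain L where L: "M = h * L" "\<not> h dvd L" using irr_cofactor[OF assms(2)] .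
  have "twist f dvd twist (twist L)" by (rule twist_dvd[OF dvd_twist_cofactor[OF assms(1) L(1) *]])
  with assms(3) have "h dvd twist (twist L)" by (rule dvd_trans)
  thus False using dvd_of_dvd_twist_twist[OF assms(2)] L(2) by blast
qed

text \<open>If they differed, \<open>g\<close> would divide the cofactor \<open>L\<close> of
  \<open>h\<close>. By symmetry \<open>f\<close> divides \<open>twist g\<close>, hence
  \<open>twist L\<close>, and again \<open>h\<close> would divide \<open>L\<close>.\<close>

lemma dvd_twist_unique:
  assumes "irr f" "irr g" "irr h" "g dvd twist f" "h dvd twist f"
  shows "g = h"
proof (rule ccontr)
  assume "g \<noteq> h"
  obtain L where L: "M = h * L" "\<not> h dvd L" using irr_cofactor[OF assms(3)] .
  have "g dvd L"
    using irr_dvd_mult[OF assms(2), of h L] irrD(3)[OF assms(2)] L(1)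
      irr_dvd_imp_eq[OF assms(2,3)] \<open>g \<noteq> h\<close> by auto
  hence "f dvd twist L"
    using dvd_twist_sym[OF assms(1,2,4)] twist_dvd dvd_trans by blast
  hence "h dvd twist (twist L)" using assms(5) twist_dvd dvd_trans by blast
  thus False using dvd_of_dvd_twist_twist[OF assms(3)] L(2) by blast
qed

text \<open>For the cofactor \<open>K\<close> of \<open>f\<close>, \<open>M\<close> cannot divide
  \<open>twist K\<close>, since a second substitution would make \<open>f\<close> divide
  \<open>K\<close>. An irreducible factor of \<open>M\<close> not dividing \<open>twist K\<close>
  must divide \<open>twist f\<close>.\<close>

lemma dvd_twist_exists:
  assumes "irr f"
  obtains g where "irr g" "g dvd twist f"
proof -
  obtain K where K: "M = f * K" "\<not> f dvd K" using irr_cofactor[OF assms] .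
  have "\<not> M dvd twist K"
  proof
    assume "M dvd twist K"
    hence "M dvd twist (twist K)" by (rule M_dvd_twist)
    thus False using dvd_of_dvd_twist_twist[OF assms, of K] irrD(3)[OF assms] K(2) dvd_trans by blast
  qed
  then obtain g where g: "irr g" "\<not> g dvd twist K" using M_dvd_if by blast
  moreover have "M = K * f" using K by simp
  ultimately show thesis using that dvd_twist_cofactor by blast
qed

text \<open>All later arguments use e_f only through these properties: its values at the irreducible
  factors, and the annihilation of whatever vanishes at \<open>f\<close>, which holds because the
  cofactor of \<open>f\<close> divides e_f.\<close>

lemma e_poly_dvd:
  assumes "irr f"
  shows "f dvd e_poly n f - 1" "\<not> f dvd e_poly n f"
    and "f dvd R \<Longrightarrow> M dvd e_poly n f * R"
    and "irr g \<Longrightarrow> g \<noteq> f \<Longrightarrow> g dvd e_poly n f"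
proof -
  obtain K where K: "M = f * K" "\<not> f dvd K" using irr_cofactor[OF assms] .
  note e = e_poly_cong[OF of_nat_n irrD(1)[OF assms] K(1)[unfolded M_eq]]
  show "f dvd e_poly n f - 1" by (fact e)
  thus "\<not> f dvd e_poly n f" using irreducible_dvd_dvd_one_diff irrD(1)[OF assms] by blast
  show "M dvd e_poly n f * R" if "f dvd R" unfolding K(1)
    using mult_dvd_mono[OF that e(1)] by (simp add: ac_simps)
  show "g dvd e_poly n f" if g: "irr g" "g \<noteq> f"
    using irr_dvd_mult[OF g(1), of f K] irrD(3)[OF g(1)] K(1) irr_dvd_imp_eq[OF g(1) assms] g(2)
      e(1) dvd_trans by blast
qed

text \<open>Both polynomials have value 1 at \<open>g\<close> and 0 at every other irreducible
  factor of \<open>M\<close>.\<close>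

lemma twist_e_poly:
  assumes "irr f" "irr g" "g dvd twist f"
  shows "M dvd twist (e_poly n f) - e_poly n g"
proof (rule M_dvd_if)
  fix h assume h: "irr h"
  show "h dvd twist (e_poly n f) - e_poly n g"
  proof (cases "h = g")
    case True
    have "h dvd twist (e_poly n f - 1)"
      using twist_dvd[OF e_poly_dvd(1)[OF assms(1)]] assms(3) True dvd_trans by blast
    moreover have "h dvd e_poly n g - 1" using True e_poly_dvd(1)[OF assms(2)] by simp
    ultimately have "h dvd twist (e_poly n f - 1) - (e_poly n g - 1)" by (rule dvd_diff)
    thus ?thesis by simp
  next
    case False
    obtain h' where h': "irr h'" "h' dvd twist h" using dvd_twist_exists[OF h] .
    have hh': "h dvd twist h'" using dvd_twist_sym[OF h h'] .
    \<comment> \<open>If the partner of \<open>h\<close> were \<open>f\<close>, uniqueness of the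
      partner of \<open>f\<close> would give \<open>h = g\<close>.\<close>
    have "h' \<noteq> f" using dvd_twist_unique[OF assms(1,2) h assms(3)] hh' False by blast
    hence "twist h' dvd twist (e_poly n f)" using e_poly_dvd(4)[OF assms(1) h'(1)] twist_dvd by blast
    hence "h dvd twist (e_poly n f)" using hh' dvd_trans by blast
    moreover have "h dvd e_poly n g" using e_poly_dvd(4)[OF assms(2) h False] .
    ultimately show ?thesis by (rule dvd_diff)
  qed
qed

end

section \<open>The polynomials \<open>star s f\<close>\<close>

lemma map_poly_to_ac_mult:
  "map_poly to_ac (p * q :: 'a::field poly) = map_poly to_ac p * map_poly to_ac q"
  by (rule poly_eqI) (simp add: coeff_map_poly coeff_mult to_ac_sum)

lemma map_poly_to_ac_dvd: "p dvd q \<Longrightarrow> map_poly to_ac (p :: 'a::field poly) dvd map_poly to_ac q"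
  by (auto elim!: dvdE simp: map_poly_to_ac_mult)

lemma map_poly_to_ac_x_pow_minus_1:
  "map_poly to_ac (x_pow_minus_1 n :: 'a::field poly) = x_pow_minus_1 n"
  by (rule poly_eqI) (simp add: coeff_map_poly x_pow_minus_1_def)

lemma poly_map_poly_to_ac_pcompose_monom:
  "poly (map_poly to_ac (pcompose p (Polynomial.monom 1 t) :: 'a::field poly)) a
    = poly (map_poly to_ac p) (a ^ t)"
proof (induction p)
  case (pCons c p)
  have add: "map_poly to_ac (p + q :: 'a poly) = map_poly to_ac p + map_poly to_ac q" for p q
    by (rule poly_eqI) (simp add: coeff_map_poly)
  show ?case using pCons
    by (simp add: pcompose_pCons add map_poly_to_ac_mult map_poly_pCons map_poly_monom poly_monom)
qed simp

text \<open>A multiple root would give a repeated linear factor of X^n - 1. The root multiset is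
  therefore a set, and the multiset product in \<open>star_closure\<close> becomes a product over a
  set, which can be reindexed.\<close>

lemma monic_dvd_x_pow_minus_1_eq_prod_roots:
  fixes p :: "'b::alg_closed_field poly"
  assumes n: "of_nat n \<noteq> (0::'b)" and p: "lead_coeff p = 1" "p dvd x_pow_minus_1 n"
  shows "proots p = mset_set {a. poly p a = 0}" "p = (\<Prod>a\<in>{a. poly p a = 0}. [:- a, 1:])"
proof -
  have nz: "p \<noteq> 0" using p(1) by auto
  show pr: "proots p = mset_set {a. poly p a = 0}"
  proof (rule multiset_eqI)
    fix a
    have "order a p \<le> 1"
    proof (rule ccontr)
      assume "\<not> order a p \<le> 1"
      hence "[:- a, 1:] ^ 2 dvd p" by (simp add: order_divides)
      from dvd_trans[OF this p(2)] obtain L where "x_pow_minus_1 n = [:- a, 1:] ^ 2 * L"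
        by (rule dvdE)
      hence L: "x_pow_minus_1 n = [:- a, 1:] * ([:- a, 1:] * L)"
        by (simp only: power2_eq_square mult.assoc)
      have "irreducible [:- a, 1:]" by (rule irreducible_linear_field_poly) simp
      from x_pow_minus_1_squarefree[OF n this L] show False by (simp only: dvd_triv_left not_True_eq_False)
    qed
    moreover have "order a p > 0 \<longleftrightarrow> poly p a = 0" using nz by (simp add: order_root)
    ultimately show "count (proots p) a = count (mset_set {a. poly p a = 0}) a"
      using nz poly_roots_finite[OF nz] by (cases "poly p a = 0") (auto simp: count_mset_set')
  qed
  obtain A where A: "p = (\<Prod>x\<in>#A. [:- x, 1:])"
    using alg_closed_imp_factorization[OF nz] p(1) by auto
  \<comment> \<open>The multiset of any factorization into monic linear factors is the root
    multiset.\<close>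
  have "proots p = A" unfolding A
  proof (induction A)
    case (add x A)
    have "(\<Prod>x\<in>#B. [:- x, 1:]) \<noteq> (0 :: 'b poly)" for B
      by (induction B) (simp_all del: mult_pCons_left)
    thus ?case using add by (simp add: proots_mult del: mult_pCons_left)
  qed simp
  with A pr show "p = (\<Prod>a\<in>{a. poly p a = 0}. [:- a, 1:])"
    by (simp add: prod_unfold_prod_mset)
qed

context power_twist
begin

text \<open>The map \<open>a \<mapsto> a ^ t\<close> sends roots of \<open>f\<close> to roots of
  \<open>g\<close> and conversely, and it is its own inverse on \<open>n\<close>-th roots of unity.
  So the roots of \<open>g\<close> are exactly the powers \<open>a ^ t = a powi s\<close> of the
  roots of \<open>f\<close>.\<close>

lemma star_eq:
  assumes s: "[int t = s] (mod int n)" and f: "irr f" and g: "irr g" and gf: "g dvd twist f"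
  shows "star_closure s f = map_poly to_ac g" "star s f = g" "self_involutive s f \<longleftrightarrow> f = g"
proof -
  define roots where "roots = (\<lambda>p :: 'a poly. {a. poly (map_poly to_ac p) a = 0})"
  have n: "of_nat n \<noteq> (0 :: 'a alg_closure)"
    using of_nat_n by (metis to_ac_of_nat to_ac_eq_0_iff)
  have dvd: "map_poly to_ac h dvd x_pow_minus_1 n" if "irr h" for h
    using map_poly_to_ac_dvd[OF irrD(3)[OF that]] by (simp add: M_eq map_poly_to_ac_x_pow_minus_1)
  have lc: "lead_coeff (map_poly to_ac h) = 1" if "irr h" for h
    using irrD(2)[OF that] by (simp add: lead_coeff_map_poly_nz)
  have pr: "proots (map_poly to_ac h) = mset_set (roots h)"
      "map_poly to_ac h = (\<Prod>a\<in>roots h. [:- a, 1:])" if "irr h" for h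
    unfolding roots_def
    by (rule monic_dvd_x_pow_minus_1_eq_prod_roots[OF n lc[OF that] dvd[OF that]])+
  have root_power: "a ^ n = 1" if "irr h" "a \<in> roots h" for h a
  proof -
    have "poly (x_pow_minus_1 n) a = 0" using dvd[OF that(1)] that(2) by (auto elim!: dvdE simp: roots_def)
    thus ?thesis by (simp add: x_pow_minus_1_def poly_monom)
  qed
  have tt: "(a ^ t) ^ t = a" if "a ^ n = 1" for a :: "'a alg_closure"
  proof -
    obtain k where k: "t * t = Suc (n * k)" by (rule t_square_eq)
    have "(a ^ t) ^ t = a ^ Suc (n * k)" by (simp only: k flip: power_mult)
    also have "\<dots> = a" using that by (simp add: power_mult)
    finally show ?thesis .
  qed
  \<comment> \<open>On \<open>n\<close>-th roots of unity an exponent matters only modulo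
    \<open>n\<close>, so the integer \<open>s\<close> may be replaced by \<open>t\<close>.\<close>
  have powi: "a powi s = a ^ t" if "a ^ n = 1" for a :: "'a alg_closure"
  proof -
    obtain k where k: "s = int t + int n * k" using s by (auto simp: cong_iff_lin)
    have "a \<noteq> 0" using that n_gt_0 by (auto simp: zero_power)
    thus ?thesis unfolding k using that by (simp add: power_int_add power_int_mult)
  qed
  \<comment> \<open>\<open>twist k\<close> takes at \<open>a\<close> the value of \<open>k\<close>
    at \<open>a ^ t\<close>, and it vanishes at the roots of its divisor \<open>h\<close>.\<close>
  have maps: "a ^ t \<in> roots k" if "irr h" "irr k" "h dvd twist k" "a \<in> roots h" for h k a
  proof -
    have "poly (map_poly to_ac (twist k)) a = 0"
      using map_poly_to_ac_dvd[OF that(3)] that(4) by (auto elim!: dvdE simp: roots_def)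
    thus ?thesis by (simp add: roots_def twist_def poly_map_poly_to_ac_pcompose_monom)
  qed
  have fg: "f dvd twist g" using dvd_twist_sym[OF f g gf] .
  have im: "roots g = (\<lambda>a. a ^ t) ` roots f"
  proof
    show "roots g \<subseteq> (\<lambda>a. a ^ t) ` roots f"
    proof
      fix b assume b: "b \<in> roots g"
      show "b \<in> (\<lambda>a. a ^ t) ` roots f"
        by (rule image_eqI[where x = "b ^ t"])
          (simp_all only: tt[OF root_power[OF g b]] maps[OF g f gf b])
    qed
    show "(\<lambda>a. a ^ t) ` roots f \<subseteq> roots g" using maps[OF f g fg] by blast
  qed
  have inj: "inj_on (\<lambda>a. a ^ t) (roots f)"
    by (rule inj_on_inverseI[where g = "\<lambda>a. a ^ t"]) (rule tt[OF root_power[OF f]])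
  have "star_closure s f = (\<Prod>a\<in>roots f. [:- (a powi s), 1:])"
    unfolding star_closure_def pr(1)[OF f] by (simp add: prod_unfold_prod_mset)
  also have "\<dots> = (\<Prod>a\<in>roots f. [:- (a ^ t), 1:])"
    using powi root_power[OF f] by (intro prod.cong) auto
  also have "\<dots> = (\<Prod>a\<in>roots g. [:- a, 1:])"
    unfolding im by (simp add: prod.reindex[OF inj])
  also have "\<dots> = map_poly to_ac g" by (rule pr(2)[OF g, symmetric])
  finally show sc: "star_closure s f = map_poly to_ac g" .
  \<comment> \<open>The coefficients come from \<open>g\<close>, hence from the base field, where
    \<open>of_ac\<close> inverts \<open>to_ac\<close>.\<close>
  show "star s f = g" unfolding star_def sc
    by (rule poly_eqI) (simp add: coeff_map_poly)
  show "self_involutive s f \<longleftrightarrow> f = g"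
  proof
    assume "self_involutive s f"
    hence "roots f = roots g" by (simp add: self_involutive_def sc roots_def)
    hence "map_poly to_ac f = map_poly to_ac g" using pr(2)[OF f] pr(2)[OF g] by simp
    hence "to_ac (coeff f i) = to_ac (coeff g i)" for i by (metis coeff_map_poly to_ac_0)
    thus "f = g" by (intro poly_eqI) simp
  next
    assume "f = g"
    thus "self_involutive s f" using sc by (simp add: self_involutive_def)
  qed
qed

text \<open>X^t - X = X (X^(t - 1) - 1), and \<open>f\<close> does not divide X. This turns
  membership among the factors of X^d - 1 into the condition on X^t - X that centrality
  produces.\<close>

lemma dvd_x_pow_minus_1_iff:
  assumes f: "irr f"
  shows "f dvd x_pow_minus_1 (gcd n (t - 1)) \<longleftrightarrow> f dvd Polynomial.monom 1 t - [:0, 1:]"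
proof -
  have eq: "Polynomial.monom 1 t - [:0, 1:] = Polynomial.monom 1 1 * (x_pow_minus_1 (t - 1) :: 'a poly)"
    using t_pos by (simp add: x_pow_minus_1_def algebra_simps mult_monom) (simp add: monom_Suc monom_0)
  note f' = irrD(1)[OF f] irrD(3)[OF f, unfolded M_eq] n_gt_0
  show ?thesis
  proof
    assume "f dvd x_pow_minus_1 (gcd n (t - 1))"
    moreover have "x_pow_minus_1 (gcd n (t - 1)) dvd (x_pow_minus_1 (t - 1) :: 'a poly)"
      by (rule x_pow_minus_1_dvd) simp
    ultimately show "f dvd Polynomial.monom 1 t - [:0, 1:]" unfolding eq by (metis dvd_mult dvd_trans)
  next
    assume "f dvd Polynomial.monom 1 t - [:0, 1:]"
    hence "f dvd x_pow_minus_1 (t - 1)" unfolding eq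
      using irr_dvd_mult[OF f] irreducible_not_dvd_monom[OF f'] by blast
    thus "f dvd x_pow_minus_1 (gcd n (t - 1))" by (rule dvd_x_pow_minus_1_gcd[OF f'])
  qed
qed

end

section \<open>Normal forms in the metacyclic group\<close>

lemma (in group) nat_pow_cong:
  assumes "x \<in> carrier G" "x [^] n = \<one>" "[i = j] (mod n)"
  shows "x [^] (i::nat) = x [^] (j::nat)"
proof -
  have "x [^] i = x [^] (i mod n)" for i
  proof -
    have "x [^] i = x [^] (n * (i div n) + i mod n)" by simp
    also have "\<dots> = (x [^] n) [^] (i div n) \<otimes> x [^] (i mod n)"
      using assms(1) by (simp add: nat_pow_mult nat_pow_pow del: mult_div_mod_eq)
    also have "\<dots> = x [^] (i mod n)" using assms(1,2) by simp
    finally show ?thesis .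
  qed
  thus ?thesis using assms(3) unfolding cong_def by metis
qed

text \<open>The form in which the group enters the algebra: the elements x^i and x^i y with
  \<open>i < n\<close> exhaust it without repetition.\<close>

locale metacyclic_normal_form = group G for G :: "('g, 'm) monoid_scheme" (structure) +
  fixes x y :: 'g and n t :: nat
  assumes n_pos: "n > 0"
    and x_closed [simp]: "x \<in> carrier G" and y_closed [simp]: "y \<in> carrier G"
    and x_pow: "x [^] n = \<one>" and y_square: "y \<otimes> y = \<one>"
    and y_x: "y \<otimes> x = x [^] t \<otimes> y"
    and normal_form: "g \<in> carrier G \<Longrightarrow> \<exists>i<n. g = x [^] i \<or> g = x [^] i \<otimes> y"
    and x_pow_inj: "i < n \<Longrightarrow> j < n \<Longrightarrow> x [^] i = x [^] j \<Longrightarrow> i = j"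
    and x_pow_neq: "x [^] (i::nat) \<otimes> y \<noteq> x [^] (j::nat)"

text \<open>
  The letters act on \<open>(i, b)\<close>, standing for \<open>x\<^sup>i y\<^sup>b\<close>, by left multiplication; the exponent
  is only meaningful modulo \<open>n\<close>.
\<close>

fun letter_act :: "int \<Rightarrow> gen \<times> bool \<Rightarrow> int \<times> bool \<Rightarrow> int \<times> bool" where
  "letter_act s (Gen_x, c) (i, b) = ((if c then i - 1 else i + 1), b)"
| "letter_act s (Gen_y, c) (i, b) = (s * i, \<not> b)"

definition word_act :: "int \<Rightarrow> gen word \<Rightarrow> int \<times> bool \<Rightarrow> int \<times> bool" where
  "word_act s w = foldr (letter_act s) w"

definition act_eq :: "nat \<Rightarrow> int \<times> bool \<Rightarrow> int \<times> bool \<Rightarrow> bool" where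
  "act_eq n p q \<longleftrightarrow> [fst p = fst q] (mod int n) \<and> snd p = snd q"

lemma act_eq_refl: "act_eq n p p"
  and act_eq_sym: "act_eq n p q \<Longrightarrow> act_eq n q p"
  and act_eq_trans: "act_eq n p q \<Longrightarrow> act_eq n q r \<Longrightarrow> act_eq n p r"
  by (auto simp: act_eq_def cong_def)

lemma word_act_append: "word_act s (u @ v) p = word_act s u (word_act s v p)"
  by (simp add: word_act_def)

lemma letter_act_cong: "act_eq n p q \<Longrightarrow> act_eq n (letter_act s l p) (letter_act s l q)"
  by (cases "(s, l, p)" rule: letter_act.cases; cases q)
    (auto simp: act_eq_def intro: cong_add cong_diff cong_mult)

lemma word_act_cong: "act_eq n p q \<Longrightarrow> act_eq n (word_act s w p) (word_act s w q)"
  by (induction w) (simp_all add: word_act_def letter_act_cong)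

lemma word_act_replicate_x:
  "word_act s (replicate k (Gen_x, c)) (i, b) = (if c then i - int k else i + int k, b)"
  by (induction k) (auto simp: word_act_def)

lemma word_act_word_power_x: "word_act s (word_power Gen_x k) (i, b) = (i + k, b)"
  by (auto simp: word_power_def word_act_replicate_x)

text \<open>The two sides of each relation act alike modulo \<open>n\<close>, because applying
  \<open>Gen_y\<close> twice multiplies the exponent by s^2, which is congruent to 1. The action
  thus gives an invariant of classes that can separate normal forms.\<close>

lemma word_act_pres_eq:
  assumes s: "[s\<^sup>2 = 1] (mod int n)"
  shows "pres_eq (metacyclic_relations n s) u v \<Longrightarrow> act_eq n (word_act s u p) (word_act s v p)"
proof (induction u v arbitrary: p rule: pres_eq.induct)
  case (pres_eq_relator u v)
  obtain i b where p: "p = (i, b)" by (cases p)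
  have ss: "[s * (s * i) = i] (mod int n)"
    using cong_scalar_right[OF s, of i] by (simp add: power2_eq_square mult.assoc)
  from pres_eq_relator show ?case unfolding metacyclic_relations_def
  proof (elim insertE emptyE Pair_inject)
    assume "u = word_power Gen_x (int n)" "v = []"
    thus ?thesis by (simp add: p word_act_word_power_x) (simp add: word_act_def act_eq_def cong_def)
  next
    assume "u = word_power Gen_y 2" "v = []"
    thus ?thesis using ss
      by (simp add: p word_power_def word_act_def act_eq_def numeral_2_eq_2)
  next
    assume uv: "u = word_power Gen_y (-1) @ word_power Gen_x 1 @ word_power Gen_y 1"
      "v = word_power Gen_x s"
    \<comment> \<open>The rightmost letter acts first: \<open>i\<close> becomes
      \<open>s * i\<close>, then \<open>s * i + 1\<close>, then \<open>s * (s * i + 1)\<close>. The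
      inverse letter of \<open>Gen_y\<close> acts as \<open>Gen_y\<close> does.\<close>
    have "word_act s u p = (s * (s * i) + s, b)"
      by (simp add: p uv(1) word_power_def word_act_def algebra_simps)
    moreover have "word_act s v p = (i + s, b)" by (simp add: p uv(2) word_act_word_power_x)
    ultimately show ?thesis using cong_add[OF ss cong_refl[of s]] by (simp add: act_eq_def)
  qed
next
  case (pres_eq_cancel a c)
  obtain i b where p: "p = (i, b)" by (cases p)
  have "[s * (s * i) = i] (mod int n)"
    using cong_scalar_right[OF s, of i] by (simp add: power2_eq_square mult.assoc)
  thus ?case by (cases a) (auto simp: p word_act_def act_eq_def)
next
  case (pres_eq_append u u' v v')
  show ?case unfolding word_act_append
    using pres_eq_append.IH act_eq_trans word_act_cong by blast
qed (blast intro: act_eq_refl act_eq_sym act_eq_trans)+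

text \<open>The relations bring every word into normal form. Different normal forms are different
  elements because they move \<open>(0, False)\<close>, the pair of the neutral element, to places
  that are distinct modulo \<open>n\<close>.\<close>

lemma metacyclic_normal_form_metacyclic_group:
  assumes n: "n > 0" and s: "[s\<^sup>2 = 1] (mod int n)" and t: "[int t = s] (mod int n)"
  shows "metacyclic_normal_form (metacyclic_group n s)
    (metacyclic_gen n s Gen_x) (metacyclic_gen n s Gen_y) n t"
proof -
  define R where "R = metacyclic_relations n s"
  define G where "G = metacyclic_group n s"
  define x y where "x = metacyclic_gen n s Gen_x" and "y = metacyclic_gen n s Gen_y"
  have Gp: "G = presented_group R" by (simp add: G_def metacyclic_group_def R_def)
  interpret group G unfolding Gp by (rule group_presented_group)
  have cl: "pres_class R w \<in> carrier G" for w by (simp add: Gp presented_group_def)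
  have mult: "pres_class R (u @ v) = pres_class R u \<otimes>\<^bsub>G\<^esub> pres_class R v" for u v
    by (simp add: Gp presented_group_mult)
  have one: "pres_class R [] = \<one>\<^bsub>G\<^esub>" by (simp add: Gp presented_group_def)
  have rel: "pres_class R u = pres_class R v" if "(u, v) \<in> metacyclic_relations n s" for u v
    unfolding pres_class_eq_iff R_def using that by (rule pres_eq_relator)
  have xc: "x = pres_class R [(Gen_x, False)]" and yc: "y = pres_class R [(Gen_y, False)]"
    by (simp_all add: x_def y_def metacyclic_gen_def R_def)
  have [simp]: "x \<in> carrier G" "y \<in> carrier G" by (simp_all add: xc yc cl)
  have inv_letter: "pres_class R [(a, True)] = inv\<^bsub>G\<^esub> pres_class R [(a, False)]" for a
  proof (rule inv_equality[symmetric])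
    show "pres_class R [(a, True)] \<otimes>\<^bsub>G\<^esub> pres_class R [(a, False)] = \<one>\<^bsub>G\<^esub>"
      using pres_eq_cancel[of R a True] unfolding mult[symmetric] one[symmetric] pres_class_eq_iff by simp
  qed (simp_all add: cl)
  have rep: "pres_class R (replicate k l) = pres_class R [l] [^]\<^bsub>G\<^esub> k" for k l
  proof (induction k)
    case (Suc k)
    have "pres_class R (replicate (Suc k) l) = pres_class R (replicate k l) \<otimes>\<^bsub>G\<^esub> pres_class R [l]"
      by (simp only: mult[symmetric] replicate_append_same replicate_Suc)
    thus ?case using Suc by simp
  qed (simp add: one)
  have x_pow: "x [^]\<^bsub>G\<^esub> n = \<one>\<^bsub>G\<^esub>"
    using rel[of "word_power Gen_x (int n)" "[]"]
    by (simp add: metacyclic_relations_def word_power_def rep one xc)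
  have y_square: "y \<otimes>\<^bsub>G\<^esub> y = \<one>\<^bsub>G\<^esub>"
    using rel[of "word_power Gen_y 2" "[]"]
    by (simp add: metacyclic_relations_def word_power_def numeral_2_eq_2 one yc flip: mult)
  have y_inv: "inv\<^bsub>G\<^esub> y = y" using y_square by (intro inv_equality) auto
  have x_inv: "inv\<^bsub>G\<^esub> x = x [^]\<^bsub>G\<^esub> (n - 1)"
  proof (rule inv_equality)
    show "x [^]\<^bsub>G\<^esub> (n - 1) \<otimes>\<^bsub>G\<^esub> x = \<one>\<^bsub>G\<^esub>"
      using x_pow n by (metis Suc_diff_1 nat_pow_Suc)
  qed simp_all
  have xs: "pres_class R (word_power Gen_x s) = x [^]\<^bsub>G\<^esub> t"
  proof (cases "s < 0")
    case False
    hence "[nat s = t] (mod n)" using t by (simp add: cong_sym_eq flip: cong_int_iff)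
    hence "x [^]\<^bsub>G\<^esub> nat s = x [^]\<^bsub>G\<^esub> t" by (rule nat_pow_cong[OF _ x_pow, rotated]) simp
    moreover have "word_power Gen_x s = replicate (nat s) (Gen_x, False)"
      using False by (simp add: word_power_def)
    ultimately show ?thesis by (simp only: rep xc[symmetric])
  next
    case True
    \<comment> \<open>Now \<open>t + k\<close> is a multiple of \<open>n\<close>, so the word of
      \<open>k\<close> inverse letters equals x^t.\<close>
    define k where "k = nat (- s)"
    have "int k = - s" using True by (simp add: k_def)
    hence "int n dvd int (t + k)" using t by (simp add: cong_iff_dvd_diff)
    hence "[t + k = 0] (mod n)" unfolding int_dvd_int_iff by (simp add: cong_0_iff)
    hence "x [^]\<^bsub>G\<^esub> (t + k) = \<one>\<^bsub>G\<^esub>" using nat_pow_cong[OF _ x_pow] by fastforce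
    hence "x [^]\<^bsub>G\<^esub> t \<otimes>\<^bsub>G\<^esub> x [^]\<^bsub>G\<^esub> k = \<one>\<^bsub>G\<^esub>" by (simp add: nat_pow_mult)
    hence "inv\<^bsub>G\<^esub> (x [^]\<^bsub>G\<^esub> k) = x [^]\<^bsub>G\<^esub> t" by (intro inv_equality) auto
    moreover have "word_power Gen_x s = replicate k (Gen_x, True)"
      using True by (simp add: word_power_def k_def)
    ultimately show ?thesis by (simp add: rep inv_letter xc[symmetric] nat_pow_inv)
  qed
  have y_x: "y \<otimes>\<^bsub>G\<^esub> x = x [^]\<^bsub>G\<^esub> t \<otimes>\<^bsub>G\<^esub> y"
  proof -
    have "y \<otimes>\<^bsub>G\<^esub> (x \<otimes>\<^bsub>G\<^esub> y) = x [^]\<^bsub>G\<^esub> t"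
    proof -
      have "pres_class R (word_power Gen_y (-1) @ word_power Gen_x 1 @ word_power Gen_y 1)
          = pres_class R (word_power Gen_x s)"
        by (rule rel) (simp add: metacyclic_relations_def)
      thus ?thesis unfolding mult xs
        by (simp add: word_power_def inv_letter xc[symmetric] yc[symmetric] y_inv)
    qed
    hence "x [^]\<^bsub>G\<^esub> t \<otimes>\<^bsub>G\<^esub> y = y \<otimes>\<^bsub>G\<^esub> (x \<otimes>\<^bsub>G\<^esub> y) \<otimes>\<^bsub>G\<^esub> y" by simp
    thus ?thesis by (simp add: m_assoc y_square)
  qed
  have y_xk: "y \<otimes>\<^bsub>G\<^esub> x [^]\<^bsub>G\<^esub> k = x [^]\<^bsub>G\<^esub> (t * k) \<otimes>\<^bsub>G\<^esub> y" for k :: nat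
  proof (induction k)
    case (Suc k)
    have "y \<otimes>\<^bsub>G\<^esub> x [^]\<^bsub>G\<^esub> Suc k = (y \<otimes>\<^bsub>G\<^esub> x [^]\<^bsub>G\<^esub> k) \<otimes>\<^bsub>G\<^esub> x" by (simp add: m_assoc)
    also have "\<dots> = x [^]\<^bsub>G\<^esub> (t * k) \<otimes>\<^bsub>G\<^esub> (y \<otimes>\<^bsub>G\<^esub> x)" by (simp add: Suc m_assoc)
    also have "\<dots> = x [^]\<^bsub>G\<^esub> (t * k + t) \<otimes>\<^bsub>G\<^esub> y" unfolding y_x by (simp add: m_assoc flip: nat_pow_mult)
    finally show ?case by (simp add: add.commute)
  qed simp
  \<comment> \<open>Letters are multiplied on from the left. Each is \<open>y\<close> or a power of
    \<open>x\<close> with natural exponent, inverses included, and \<open>y_xk\<close> moves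
    \<open>y\<close> to the right.\<close>
  have nf: "\<exists>i::nat. pres_class R w = x [^]\<^bsub>G\<^esub> i \<or> pres_class R w = x [^]\<^bsub>G\<^esub> i \<otimes>\<^bsub>G\<^esub> y" for w
  proof (induction w)
    case Nil
    show ?case by (intro exI[of _ 0]) (simp add: one)
  next
    case (Cons l w)
    obtain i :: nat where i: "pres_class R w = x [^]\<^bsub>G\<^esub> i \<or> pres_class R w = x [^]\<^bsub>G\<^esub> i \<otimes>\<^bsub>G\<^esub> y"
      using Cons by blast
    have split: "pres_class R (l # w) = pres_class R [l] \<otimes>\<^bsub>G\<^esub> pres_class R w"
      using mult[of "[l]" w] by simp
    have "pres_class R [l] = y \<or> (\<exists>j::nat. pres_class R [l] = x [^]\<^bsub>G\<^esub> j)"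
    proof (cases l)
      case (Pair a c)
      have "\<exists>j::nat. x = x [^]\<^bsub>G\<^esub> j" by (rule exI[of _ 1]) simp
      moreover have "\<exists>j::nat. inv\<^bsub>G\<^esub> x = x [^]\<^bsub>G\<^esub> j" using x_inv by blast
      ultimately show ?thesis using Pair
        by (cases a; cases c) (simp_all add: inv_letter y_inv xc[symmetric] yc[symmetric])
    qed
    thus ?case
    proof (elim disjE exE)
      assume l: "pres_class R [l] = y"
      have "pres_class R (l # w) = x [^]\<^bsub>G\<^esub> (t * i) \<otimes>\<^bsub>G\<^esub> y \<or> pres_class R (l # w) = x [^]\<^bsub>G\<^esub> (t * i)"
      proof (rule disjE[OF i])
        assume "pres_class R w = x [^]\<^bsub>G\<^esub> i"
        thus ?thesis by (simp add: split l y_xk)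
      next
        assume "pres_class R w = x [^]\<^bsub>G\<^esub> i \<otimes>\<^bsub>G\<^esub> y"
        hence "pres_class R (l # w) = (y \<otimes>\<^bsub>G\<^esub> x [^]\<^bsub>G\<^esub> i) \<otimes>\<^bsub>G\<^esub> y" by (simp add: split l m_assoc)
        also have "\<dots> = x [^]\<^bsub>G\<^esub> (t * i)" unfolding y_xk by (simp add: m_assoc y_square)
        finally show ?thesis by blast
      qed
      thus ?thesis by blast
    next
      fix j :: nat assume l: "pres_class R [l] = x [^]\<^bsub>G\<^esub> j"
      have "pres_class R (l # w) = x [^]\<^bsub>G\<^esub> (j + i) \<or> pres_class R (l # w) = x [^]\<^bsub>G\<^esub> (j + i) \<otimes>\<^bsub>G\<^esub> y"
        using i by (auto simp: split l m_assoc simp flip: nat_pow_mult)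
      thus ?thesis by blast
    qed
  qed
  have inv: "act_eq n (word_act s u (0, False)) (word_act s v (0, False))"
    if "pres_class R u = pres_class R v" for u v
    using that word_act_pres_eq[OF s] unfolding R_def pres_class_eq_iff by blast
  have xk: "x [^]\<^bsub>G\<^esub> k = pres_class R (replicate k (Gen_x, False))" for k
    by (simp add: rep xc)
  have act_x: "word_act s (replicate k (Gen_x, False)) (0, False) = (int k, False)" for k
    by (simp add: word_act_replicate_x)
  have act_xy: "word_act s (replicate k (Gen_x, False) @ [(Gen_y, False)]) (0, False) = (int k, True)" for k
    unfolding word_act_append by (simp add: word_act_def[of s "[(Gen_y, False)]"] word_act_replicate_x)
  have "metacyclic_normal_form G x y n t"
  proof unfold_locales
    fix g assume "g \<in> carrier G"
    then obtain w where "g = pres_class R w" by (auto simp: Gp presented_group_def)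
    then obtain i :: nat where i: "g = x [^]\<^bsub>G\<^esub> i \<or> g = x [^]\<^bsub>G\<^esub> i \<otimes>\<^bsub>G\<^esub> y" using nf by blast
    have "x [^]\<^bsub>G\<^esub> i = x [^]\<^bsub>G\<^esub> (i mod n)" by (rule nat_pow_cong[OF _ x_pow]) simp_all
    thus "\<exists>i<n. g = x [^]\<^bsub>G\<^esub> i \<or> g = x [^]\<^bsub>G\<^esub> i \<otimes>\<^bsub>G\<^esub> y"
      using i n by (metis mod_less_divisor)
  next
    fix i j :: nat assume "i < n" "j < n" "x [^]\<^bsub>G\<^esub> i = x [^]\<^bsub>G\<^esub> j"
    hence "[int i = int j] (mod int n)" using inv[of "replicate i (Gen_x, False)" "replicate j (Gen_x, False)"]
      unfolding xk act_x by (simp add: act_eq_def)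
    thus "i = j" using \<open>i < n\<close> \<open>j < n\<close> by (simp add: cong_int_iff cong_less_modulus_unique_nat)
  next
    fix i j :: nat
    show "x [^]\<^bsub>G\<^esub> i \<otimes>\<^bsub>G\<^esub> y \<noteq> x [^]\<^bsub>G\<^esub> j"
    proof
      assume "x [^]\<^bsub>G\<^esub> i \<otimes>\<^bsub>G\<^esub> y = x [^]\<^bsub>G\<^esub> j"
      from inv[OF this[unfolded xk yc mult[symmetric]]] show False
        by (simp add: act_x act_xy act_eq_def)
    qed
  qed (use n x_pow y_square y_x in simp_all)
  thus ?thesis by (simp add: G_def x_def y_def)
qed

section \<open>The group algebra\<close>

lemma group_algebra_simps:
  "(a \<oplus>\<^bsub>group_algebra G\<^esub> b) = (\<lambda>g. a g + b g)"
  "\<zero>\<^bsub>group_algebra G\<^esub> = (\<lambda>g. 0)"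
  "\<one>\<^bsub>group_algebra G\<^esub> = ga_single 1 \<one>\<^bsub>G\<^esub>"
  by (auto simp: group_algebra_def ga_single_def fun_eq_iff)

lemma group_algebra_outside:
  assumes "a \<in> carrier (group_algebra G)" "h \<notin> carrier G"
  shows "a h = 0"
  using assms by (auto simp: group_algebra_def)

lemma ga_single_closed [simp]: "g \<in> carrier G \<Longrightarrow> ga_single c g \<in> carrier (group_algebra G)"
  by (auto simp: group_algebra_def ga_single_def intro: finite_subset[of _ "{g}"])

lemma ga_single_mult:
  "ga_single c g \<otimes>\<^bsub>group_algebra G\<^esub> ga_single c' g' = ga_single (c * c') (g \<otimes>\<^bsub>G\<^esub> g')"
proof
  fix h
  show "(ga_single c g \<otimes>\<^bsub>group_algebra G\<^esub> ga_single c' g') h = ga_single (c * c') (g \<otimes>\<^bsub>G\<^esub> g') h"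
    by (subst group_algebra_mult[where S = "{g}" and T = "{g'}"]) (auto simp: ga_single_def split: if_splits)
qed

section \<open>Substituting a group element into polynomials\<close>

context group
begin

lemma ga_single_mult_left:
  assumes "g \<in> carrier G" "a \<in> carrier (group_algebra G)" "h \<in> carrier G"
  shows "(ga_single c g \<otimes>\<^bsub>group_algebra G\<^esub> a) h = c * a (inv g \<otimes> h)"
proof -
  \<comment> \<open>This index joins the support of \<open>a\<close> because the sum below is
    evaluated at it even where \<open>a\<close> vanishes.\<close>
  let ?T = "insert (inv g \<otimes> h) {k. a k \<noteq> 0}"
  have T: "finite ?T" "?T \<subseteq> carrier G" using assms by (auto simp: group_algebra_def)
  have "(ga_single c g \<otimes>\<^bsub>group_algebra G\<^esub> a) h = (\<Sum>k\<in>?T. if g \<otimes> k = h then c * a k else 0)"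
    by (subst group_algebra_mult[where S = "{g}" and T = ?T])
      (use T in \<open>auto simp: ga_single_def cong: if_cong split: if_splits\<close>)
  also have "\<dots> = (\<Sum>k\<in>?T. if k = inv g \<otimes> h then c * a k else 0)"
  proof (intro sum.cong refl if_cong)
    fix k assume "k \<in> ?T"
    hence "k \<in> carrier G" using T by blast
    thus "(g \<otimes> k = h) = (k = inv g \<otimes> h)" using assms by (metis inv_solve_left)
  qed
  also have "\<dots> = c * a (inv g \<otimes> h)" using T by simp
  finally show ?thesis .
qed

lemma ga_single_mult_right:
  assumes "g \<in> carrier G" "a \<in> carrier (group_algebra G)" "h \<in> carrier G"
  shows "(a \<otimes>\<^bsub>group_algebra G\<^esub> ga_single c g) h = a (h \<otimes> inv g) * c"
proof -
  let ?T = "insert (h \<otimes> inv g) {k. a k \<noteq> 0}"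
  have T: "finite ?T" "?T \<subseteq> carrier G" using assms by (auto simp: group_algebra_def)
  have "(a \<otimes>\<^bsub>group_algebra G\<^esub> ga_single c g) h = (\<Sum>k\<in>?T. if k \<otimes> g = h then a k * c else 0)"
    by (subst group_algebra_mult[where T = "{g}" and S = ?T])
      (use T in \<open>auto simp: ga_single_def cong: if_cong split: if_splits\<close>)
  also have "\<dots> = (\<Sum>k\<in>?T. if k = h \<otimes> inv g then a k * c else 0)"
  proof (intro sum.cong refl if_cong)
    fix k assume "k \<in> ?T"
    hence "k \<in> carrier G" using T by blast
    thus "(k \<otimes> g = h) = (k = h \<otimes> inv g)" using assms by (metis inv_solve_right)
  qed
  also have "\<dots> = a (h \<otimes> inv g) * c" using T by simp
  finally show ?thesis .
qed

text \<open>Any degree bound can serve as the range of summation, so polynomials of different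
  degrees can be compared over common indices.\<close>

lemma ga_subst_eq:
  assumes "Polynomial.degree p \<le> N"
  shows "ga_subst G g p h = (\<Sum>i\<le>N. if h = g [^] i then coeff p i else 0)"
  unfolding ga_subst_def ga_single_def
  by (rule sum.mono_neutral_left) (use assms in \<open>auto simp: coeff_eq_0\<close>)

lemma ga_subst_0 [simp]: "ga_subst G g 0 = (\<lambda>h. 0)"
  by (auto simp: ga_subst_def ga_single_def)

lemma ga_subst_outside: "(\<And>i::nat. h \<noteq> g [^] i) \<Longrightarrow> ga_subst G g p h = 0"
  by (simp add: ga_subst_def ga_single_def)

lemma ga_subst_add: "ga_subst G g (p + q) = (\<lambda>h. ga_subst G g p h + ga_subst G g q h)"
proof
  fix h
  let ?N = "max (Polynomial.degree p) (Polynomial.degree q)"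
  have "Polynomial.degree (p + q) \<le> ?N" by (rule Polynomial.degree_add_le_max)
  thus "ga_subst G g (p + q) h = ga_subst G g p h + ga_subst G g q h"
    by (subst (1 2 3) ga_subst_eq[where N = ?N]) (auto simp flip: sum.distrib intro!: sum.cong)
qed

lemma ga_subst_monom: "ga_subst G g (Polynomial.monom c k) = ga_single c (g [^] k)"
proof
  fix h
  have "ga_subst G g (Polynomial.monom c k) h
      = (\<Sum>i\<le>k. if h = g [^] i then coeff (Polynomial.monom c k) i else 0)"
    by (rule ga_subst_eq) (rule Polynomial.degree_monom_le)
  also have "\<dots> = (\<Sum>i\<le>k. if i = k then (if h = g [^] k then c else 0) else 0)"
    by (intro sum.cong) auto
  finally show "ga_subst G g (Polynomial.monom c k) h = ga_single c (g [^] k) h"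
    by (simp add: ga_single_def)
qed

lemma ga_subst_const: "ga_subst G g [:c:] = ga_single c \<one>"
  using ga_subst_monom[of g c 0] by (simp add: monom_0)

lemma ga_subst_closed [simp]:
  assumes "g \<in> carrier G"
  shows "ga_subst G g p \<in> carrier (group_algebra G)"
proof -
  have "{h. ga_subst G g p h \<noteq> 0} \<subseteq> (\<lambda>i. g [^] i) ` {..Polynomial.degree p}"
  proof
    fix h assume "h \<in> {h. ga_subst G g p h \<noteq> 0}"
    hence "(\<Sum>i\<le>Polynomial.degree p. if h = g [^] i then coeff p i else 0) \<noteq> 0"
      by (simp add: ga_subst_eq[OF order_refl])
    then obtain i where "i \<in> {..Polynomial.degree p}" "(if h = g [^] i then coeff p i else 0) \<noteq> 0"
      by (rule sum.not_neutral_contains_not_neutral)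
    thus "h \<in> (\<lambda>i. g [^] i) ` {..Polynomial.degree p}" by (auto split: if_splits)
  qed
  moreover from this have "{h. ga_subst G g p h \<noteq> 0} \<subseteq> carrier G" using assms by auto
  ultimately show ?thesis using finite_subset by (fastforce simp: group_algebra_def)
qed

lemma ga_subst_smult:
  assumes g: "g \<in> carrier G"
  shows "ga_subst G g (Polynomial.smult c p :: 'c::field poly) = ga_single c \<one> \<otimes>\<^bsub>group_algebra G\<^esub> ga_subst G g p"
proof
  interpret A: ring "group_algebra G :: ('a \<Rightarrow> 'c) ring" by (rule ring_group_algebra) (rule is_group)
  fix h
  have cl: "ga_single c \<one> \<otimes>\<^bsub>group_algebra G\<^esub> ga_subst G g p \<in> carrier (group_algebra G)"
    using g by simp
  show "ga_subst G g (Polynomial.smult c p) h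
      = (ga_single c \<one> \<otimes>\<^bsub>group_algebra G\<^esub> ga_subst G g p) h"
  proof (cases "h \<in> carrier G")
    case True
    have "Polynomial.degree (Polynomial.smult c p) \<le> Polynomial.degree p"
      by (rule Polynomial.degree_smult_le)
    thus ?thesis using True g
      by (simp add: ga_single_mult_left ga_subst_eq[where N = "Polynomial.degree p"] sum_distrib_left
          if_distrib cong: if_cong)
  qed (use group_algebra_outside[OF cl] group_algebra_outside[OF ga_subst_closed[OF g]] in simp)
qed

lemma ga_subst_shift:
  assumes g: "g \<in> carrier G"
  shows "ga_subst G g (pCons 0 p :: 'c::field poly) = ga_single 1 g \<otimes>\<^bsub>group_algebra G\<^esub> ga_subst G g p"
proof
  interpret A: ring "group_algebra G :: ('a \<Rightarrow> 'c) ring" by (rule ring_group_algebra) (rule is_group)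
  fix h
  have cl: "ga_single 1 g \<otimes>\<^bsub>group_algebra G\<^esub> ga_subst G g p \<in> carrier (group_algebra G)"
    using g by simp
  show "ga_subst G g (pCons 0 p) h = (ga_single 1 g \<otimes>\<^bsub>group_algebra G\<^esub> ga_subst G g p) h"
  proof (cases "h \<in> carrier G")
    case True
    have "Polynomial.degree (pCons 0 p) \<le> Suc (Polynomial.degree p)" by (rule degree_pCons_le)
    hence "ga_subst G g (pCons 0 p) h
        = (\<Sum>i\<le>Suc (Polynomial.degree p). if h = g [^] i then coeff (pCons 0 p) i else 0)"
      by (rule ga_subst_eq)
    also have "\<dots> = (\<Sum>i\<le>Polynomial.degree p. if h = g [^] Suc i then coeff p i else 0)"
      \<comment> \<open>The term of index 0 drops out because the constant coefficient is 0.\<close>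
      by (subst sum.atMost_Suc_shift) (simp cong: if_cong)
    also have "\<dots> = (\<Sum>i\<le>Polynomial.degree p. if inv g \<otimes> h = g [^] i then coeff p i else 0)"
    proof (intro sum.cong refl if_cong)
      fix i
      show "(h = g [^] Suc i) = (inv g \<otimes> h = g [^] i)"
        unfolding nat_pow_Suc2[OF g] using g True by (metis inv_solve_left' nat_pow_closed)
    qed
    also have "\<dots> = ga_subst G g p (inv g \<otimes> h)" by (rule ga_subst_eq[symmetric]) simp
    finally show ?thesis using True g by (simp add: ga_single_mult_left)
  qed (use group_algebra_outside[OF cl] group_algebra_outside[OF ga_subst_closed[OF g]] in simp)
qed

lemma ga_subst_pCons:
  assumes g: "g \<in> carrier G"
  shows "ga_subst G g (pCons c p) = ga_single c \<one> \<oplus>\<^bsub>group_algebra G\<^esub>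
    ga_single 1 g \<otimes>\<^bsub>group_algebra G\<^esub> ga_subst G g p"
proof -
  have "ga_subst G g ([:c:] + pCons 0 p) = ga_single c \<one> \<oplus>\<^bsub>group_algebra G\<^esub>
    ga_single 1 g \<otimes>\<^bsub>group_algebra G\<^esub> ga_subst G g p"
    unfolding ga_subst_add ga_subst_shift[OF g] ga_subst_const by (simp add: group_algebra_simps)
  thus ?thesis by simp
qed

text \<open>Induction along Horner's scheme: scalars and the variable already correspond to
  multiplication by \<open>ga_single c \<one>\<close> and \<open>ga_single 1 g\<close>.\<close>

lemma ga_subst_mult:
  assumes g: "g \<in> carrier G"
  shows "ga_subst G g (p * q :: 'c::field poly) = ga_subst G g p \<otimes>\<^bsub>group_algebra G\<^esub> ga_subst G g q"
proof (induction p)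
  interpret A: ring "group_algebra G :: ('a \<Rightarrow> 'c) ring" by (rule ring_group_algebra) (rule is_group)
  {
    case 0
    show ?case using A.l_null[OF ga_subst_closed[OF g, of q]] by (simp add: group_algebra_simps)
  next
    case (pCons c p)
    have "ga_subst G g (pCons c p * q) = ga_subst G g (Polynomial.smult c q)
        \<oplus>\<^bsub>group_algebra G\<^esub> ga_subst G g (pCons 0 (p * q))"
      by (simp add: ga_subst_add group_algebra_simps)
    also have "\<dots> = ga_subst G g (pCons c p) \<otimes>\<^bsub>group_algebra G\<^esub> ga_subst G g q"
      unfolding ga_subst_smult[OF g] ga_subst_shift[OF g] pCons.IH
      unfolding ga_subst_pCons[OF g]
      using g by (simp add: A.l_distr A.m_assoc)
    finally show ?case .
  }
qed

end

section \<open>Elements P(x) + Q(x) y and their uniqueness modulo X^n - 1\<close>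

context metacyclic_normal_form
begin

text \<open>The relation \<open>y_x\<close> is carried through Horner's scheme; scalars commute with
  \<open>y\<close>.\<close>

lemma ga_single_y_ga_subst:
  "ga_single 1 y \<otimes>\<^bsub>group_algebra G\<^esub> ga_subst G x p
    = ga_subst G x (pcompose p (Polynomial.monom 1 t)) \<otimes>\<^bsub>group_algebra G\<^esub> (ga_single 1 y :: 'g \<Rightarrow> 'b::field)"
proof (induction p)
  interpret A: ring "group_algebra G :: ('g \<Rightarrow> 'b) ring" by (rule ring_group_algebra) (rule is_group)
  let ?A = "group_algebra G :: ('g \<Rightarrow> 'b) ring"
  {
    case 0
    have y: "(ga_single 1 y :: 'g \<Rightarrow> 'b) \<in> carrier ?A" by simp
    show ?case using A.l_null[OF y] A.r_null[OF y] by (simp add: group_algebra_simps)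
  next
    case (pCons c p)
    let ?Y = "ga_single 1 y :: 'g \<Rightarrow> 'b" and ?X = "ga_single 1 x :: 'g \<Rightarrow> 'b"
    have XY: "?Y \<otimes>\<^bsub>?A\<^esub> ?X = ga_single 1 (x [^] t) \<otimes>\<^bsub>?A\<^esub> ?Y" by (simp add: ga_single_mult y_x)
    have cY: "?Y \<otimes>\<^bsub>?A\<^esub> ga_single c \<one> = ga_single c \<one> \<otimes>\<^bsub>?A\<^esub> ?Y" by (simp add: ga_single_mult)
    have "?Y \<otimes>\<^bsub>?A\<^esub> ga_subst G x (pCons c p)
        = ?Y \<otimes>\<^bsub>?A\<^esub> ga_single c \<one> \<oplus>\<^bsub>?A\<^esub> (?Y \<otimes>\<^bsub>?A\<^esub> ?X) \<otimes>\<^bsub>?A\<^esub> ga_subst G x p"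
      by (simp add: ga_subst_pCons A.r_distr A.m_assoc)
    also have "\<dots> = ga_single c \<one> \<otimes>\<^bsub>?A\<^esub> ?Y
        \<oplus>\<^bsub>?A\<^esub> ga_single 1 (x [^] t) \<otimes>\<^bsub>?A\<^esub> (?Y \<otimes>\<^bsub>?A\<^esub> ga_subst G x p)"
      unfolding XY cY by (simp add: A.m_assoc)
    also have "\<dots> = (ga_single c \<one> \<oplus>\<^bsub>?A\<^esub> ga_single 1 (x [^] t) \<otimes>\<^bsub>?A\<^esub>
        ga_subst G x (pcompose p (Polynomial.monom 1 t))) \<otimes>\<^bsub>?A\<^esub> ?Y"
      unfolding pCons.IH by (simp add: A.l_distr A.m_assoc)
    also have "ga_single c \<one> \<oplus>\<^bsub>?A\<^esub> ga_single 1 (x [^] t) \<otimes>\<^bsub>?A\<^esub>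
        ga_subst G x (pcompose p (Polynomial.monom 1 t))
        = ga_subst G x (pcompose (pCons c p) (Polynomial.monom 1 t))"
      unfolding pcompose_pCons ga_subst_add
      by (simp add: ga_subst_mult ga_subst_monom ga_subst_const group_algebra_simps)
    finally show ?case .
  }
qed

definition pair_elem :: "'b::field poly \<Rightarrow> 'b poly \<Rightarrow> 'g \<Rightarrow> 'b" where
  "pair_elem P Q = ga_subst G x P \<oplus>\<^bsub>group_algebra G\<^esub> ga_subst G x Q \<otimes>\<^bsub>group_algebra G\<^esub> ga_single 1 y"

lemma pair_elem_closed [simp]: "pair_elem P (Q :: 'b::field poly) \<in> carrier (group_algebra G)"
proof -
  interpret A: ring "group_algebra G :: ('g \<Rightarrow> 'b::field) ring" by (rule ring_group_algebra) (rule is_group)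
  show ?thesis by (simp add: pair_elem_def)
qed

lemma pair_elem_0_right: "pair_elem (P :: 'b::field poly) 0 = ga_subst G x P"
proof -
  interpret A: ring "group_algebra G :: ('g \<Rightarrow> 'b::field) ring" by (rule ring_group_algebra) (rule is_group)
  have "\<zero>\<^bsub>group_algebra G\<^esub> \<otimes>\<^bsub>group_algebra G\<^esub> ga_single 1 y
      = (\<zero>\<^bsub>group_algebra G\<^esub> :: 'g \<Rightarrow> 'b)"
    by (rule A.l_null) simp
  thus ?thesis by (simp add: pair_elem_def group_algebra_simps)
qed

lemma pair_elem_add:
  "pair_elem P Q \<oplus>\<^bsub>group_algebra G\<^esub> pair_elem P' Q' = pair_elem (P + P') (Q + Q' :: 'b::field poly)"
proof -
  interpret A: ring "group_algebra G :: ('g \<Rightarrow> 'b::field) ring" by (rule ring_group_algebra) (rule is_group)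
  have add: "ga_subst G x (p + q :: 'b poly) = ga_subst G x p \<oplus>\<^bsub>group_algebra G\<^esub> ga_subst G x q" for p q
    by (simp add: ga_subst_add group_algebra_simps)
  show ?thesis unfolding pair_elem_def add by (simp add: A.l_distr A.a_ac)
qed

text \<open>Expand, move \<open>y\<close> to the right past \<open>P'\<close> and \<open>Q'\<close>
  at the price of the substitution, and use that \<open>y\<close> squares to 1.\<close>

lemma pair_elem_mult:
  "pair_elem P Q \<otimes>\<^bsub>group_algebra G\<^esub> pair_elem P' Q'
    = pair_elem (P * P' + Q * pcompose Q' (Polynomial.monom 1 t))
        (P * Q' + Q * pcompose P' (Polynomial.monom 1 t) :: 'b::field poly)"
proof -
  let ?A = "group_algebra G :: ('g \<Rightarrow> 'b) ring"
  interpret A: ring ?A by (rule ring_group_algebra) (rule is_group)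
  let ?Y = "ga_single 1 y :: 'g \<Rightarrow> 'b" and ?f = "ga_subst G x :: 'b poly \<Rightarrow> _"
  let ?s = "\<lambda>p :: 'b poly. pcompose p (Polynomial.monom 1 t)"
  have add: "?f (p + q) = ?f p \<oplus>\<^bsub>?A\<^esub> ?f q" for p q by (simp add: ga_subst_add group_algebra_simps)
  have mult: "?f (p * q) = ?f p \<otimes>\<^bsub>?A\<^esub> ?f q" for p q by (simp add: ga_subst_mult)
  have YY: "?Y \<otimes>\<^bsub>?A\<^esub> ?Y = \<one>\<^bsub>?A\<^esub>" by (simp add: ga_single_mult y_square group_algebra_simps)
  have [simp]: "?f p \<in> carrier ?A" "?Y \<in> carrier ?A" for p by simp_all
  have y1: "(?f q \<otimes>\<^bsub>?A\<^esub> ?Y) \<otimes>\<^bsub>?A\<^esub> ?f p = ?f (q * ?s p) \<otimes>\<^bsub>?A\<^esub> ?Y" for p q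
    unfolding mult by (simp add: A.m_assoc ga_single_y_ga_subst)
  have y2: "(?f q \<otimes>\<^bsub>?A\<^esub> ?Y) \<otimes>\<^bsub>?A\<^esub> (?f p \<otimes>\<^bsub>?A\<^esub> ?Y) = ?f (q * ?s p)" for p q
  proof -
    have "(?f q \<otimes>\<^bsub>?A\<^esub> ?Y) \<otimes>\<^bsub>?A\<^esub> (?f p \<otimes>\<^bsub>?A\<^esub> ?Y) = ((?f q \<otimes>\<^bsub>?A\<^esub> ?Y) \<otimes>\<^bsub>?A\<^esub> ?f p) \<otimes>\<^bsub>?A\<^esub> ?Y"
      by (simp add: A.m_assoc)
    also have "\<dots> = ?f (q * ?s p) \<otimes>\<^bsub>?A\<^esub> (?Y \<otimes>\<^bsub>?A\<^esub> ?Y)" unfolding y1 by (rule A.m_assoc) simp_all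
    also have "\<dots> = ?f (q * ?s p)" unfolding YY by simp
    finally show ?thesis .
  qed
  have "pair_elem P Q \<otimes>\<^bsub>?A\<^esub> pair_elem P' Q'
      = (?f P \<otimes>\<^bsub>?A\<^esub> ?f P' \<oplus>\<^bsub>?A\<^esub> ?f P \<otimes>\<^bsub>?A\<^esub> (?f Q' \<otimes>\<^bsub>?A\<^esub> ?Y))
        \<oplus>\<^bsub>?A\<^esub> ((?f Q \<otimes>\<^bsub>?A\<^esub> ?Y) \<otimes>\<^bsub>?A\<^esub> ?f P'
          \<oplus>\<^bsub>?A\<^esub> (?f Q \<otimes>\<^bsub>?A\<^esub> ?Y) \<otimes>\<^bsub>?A\<^esub> (?f Q' \<otimes>\<^bsub>?A\<^esub> ?Y))"
    unfolding pair_elem_def by (simp add: A.l_distr A.r_distr A.a_ac)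
  also have "\<dots> = (?f (P * P') \<oplus>\<^bsub>?A\<^esub> ?f (P * Q') \<otimes>\<^bsub>?A\<^esub> ?Y)
      \<oplus>\<^bsub>?A\<^esub> (?f (Q * ?s P') \<otimes>\<^bsub>?A\<^esub> ?Y \<oplus>\<^bsub>?A\<^esub> ?f (Q * ?s Q'))"
    unfolding y1 y2 mult by (simp add: A.m_assoc)
  also have "\<dots> = pair_elem (P * P' + Q * ?s Q') (P * Q' + Q * ?s P')"
    unfolding pair_elem_def add by (simp add: A.l_distr A.a_ac)
  finally show ?thesis .
qed

text \<open>The substitution sends X^n to x^n = 1, hence X^n - 1 and all its multiples to 0.\<close>

lemma ga_subst_x_pow_minus_1: "ga_subst G x (x_pow_minus_1 n * p :: 'b::field poly) = (\<lambda>h. 0)"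
proof -
  let ?A = "group_algebra G :: ('g \<Rightarrow> 'b) ring"
  interpret A: ring ?A by (rule ring_group_algebra) (rule is_group)
  have "ga_subst G x (x_pow_minus_1 n + 1 :: 'b poly) h = ga_subst G x (x_pow_minus_1 n) h + ga_subst G x 1 h" for h
    by (simp add: ga_subst_add)
  moreover have "ga_subst G x (x_pow_minus_1 n + 1 :: 'b poly) = ga_subst G x 1"
    using ga_subst_monom[of x "1::'b" n] ga_subst_const[of x "1::'b"]
    by (simp add: x_pow_minus_1_def x_pow one_pCons)
  ultimately have "ga_subst G x (x_pow_minus_1 n :: 'b poly) = \<zero>\<^bsub>?A\<^esub>"
    by (auto simp: fun_eq_iff group_algebra_simps)
  thus ?thesis by (simp add: ga_subst_mult) (simp add: group_algebra_simps)
qed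

lemma ga_subst_coeff:
  assumes "Polynomial.degree p < n" "k < n"
  shows "ga_subst G x p (x [^] k) = coeff p k"
proof -
  have "ga_subst G x p (x [^] k) = (\<Sum>i\<le>n - 1. if x [^] k = x [^] i then coeff p i else 0)"
    by (rule ga_subst_eq) (use assms in simp)
  also have "\<dots> = (\<Sum>i\<le>n - 1. if i = k then coeff p i else 0)"
  proof (intro sum.cong refl if_cong)
    fix i assume "i \<in> {..n - 1}"
    hence "i < n" using n_pos by auto
    thus "(x [^] k = x [^] i) = (i = k)" using assms(2) x_pow_inj by blast
  qed
  also have "\<dots> = coeff p k" using assms(2) by simp
  finally show ?thesis .
qed

text \<open>The x^i with \<open>i < n\<close> are distinct and never of the form x^j y, so no two
  coefficients are collected at the same group element.\<close>

lemma pair_elem_coeff: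
  assumes "Polynomial.degree P < n" "Polynomial.degree (Q :: 'b::field poly) < n" "k < n"
  shows "pair_elem P Q (x [^] k) = coeff P k" "pair_elem P Q (x [^] k \<otimes> y) = coeff Q k"
proof -
  have y_inv: "inv y = y" using y_square by (intro inv_equality) auto
  have 1: "ga_subst G x p (x [^] k \<otimes> y) = 0" for p :: "'b poly"
    by (rule ga_subst_outside) (rule x_pow_neq)
  show "pair_elem P Q (x [^] k) = coeff P k"
    unfolding pair_elem_def using assms
    by (simp add: group_algebra_simps ga_single_mult_right y_inv 1 ga_subst_coeff)
  have "x [^] k \<otimes> y \<otimes> y = x [^] k" by (simp add: m_assoc y_square)
  thus "pair_elem P Q (x [^] k \<otimes> y) = coeff Q k"
    unfolding pair_elem_def using assms
    by (simp add: group_algebra_simps ga_single_mult_right y_inv 1 ga_subst_coeff)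
qed

lemma degree_x_pow_minus_1: "Polynomial.degree (x_pow_minus_1 n :: 'b::field poly) = n"
proof -
  have "Polynomial.degree (Polynomial.monom 1 n + (- 1) :: 'b poly) = Polynomial.degree (Polynomial.monom 1 n :: 'b poly)"
    by (rule Polynomial.degree_add_eq_left) (use n_pos in \<open>simp add: Polynomial.degree_monom_eq\<close>)
  thus ?thesis by (simp add: x_pow_minus_1_def Polynomial.degree_monom_eq)
qed

text \<open>\<open>P\<close> and \<open>Q\<close> may be replaced by their remainders modulo X^n -
  1. These have degree below \<open>n\<close>, so their coefficients are values of the
  element.\<close>

lemma pair_elem_eq_0_iff:
  "pair_elem P Q = \<zero>\<^bsub>group_algebra G\<^esub>
    \<longleftrightarrow> x_pow_minus_1 n dvd P \<and> x_pow_minus_1 n dvd (Q :: 'b::field poly)"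
proof -
  let ?A = "group_algebra G :: ('g \<Rightarrow> 'b) ring"
  interpret A: ring ?A by (rule ring_group_algebra) (rule is_group)
  let ?M = "x_pow_minus_1 n :: 'b poly"
  have M: "?M \<noteq> 0" using n_pos by (rule x_pow_minus_1_nonzero)
  have red: "ga_subst G x p = ga_subst G x (p mod ?M)" for p
  proof -
    have "ga_subst G x (?M * (p div ?M) + p mod ?M) = ga_subst G x (p mod ?M)"
      unfolding ga_subst_add ga_subst_x_pow_minus_1 by simp
    thus ?thesis by simp
  qed
  have deg: "Polynomial.degree (p mod ?M) < n" for p
    using degree_mod_less'[of ?M p] M degree_x_pow_minus_1[where 'b = 'b] n_pos by (cases "p mod ?M = 0") auto
  have eq: "pair_elem P Q = pair_elem (P mod ?M) (Q mod ?M)"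
    unfolding pair_elem_def using red by metis
  show ?thesis
  proof
    assume 0: "pair_elem P Q = \<zero>\<^bsub>?A\<^esub>"
    have "coeff (P mod ?M) k = 0 \<and> coeff (Q mod ?M) k = 0" for k
    proof (cases "k < n")
      case True
      show ?thesis using pair_elem_coeff[OF deg deg True, of P Q] 0 unfolding eq
        by (simp add: group_algebra_simps)
    next
      case False
      thus ?thesis using deg[of P] deg[of Q] by (simp add: coeff_eq_0)
    qed
    hence "P mod ?M = 0" "Q mod ?M = 0" by (auto intro: poly_eqI)
    thus "?M dvd P \<and> ?M dvd Q" by (simp add: mod_eq_0_iff_dvd)
  next
    assume "?M dvd P \<and> ?M dvd Q"
    hence "P mod ?M = 0" "Q mod ?M = 0" by (simp_all add: mod_eq_0_iff_dvd)
    thus "pair_elem P Q = \<zero>\<^bsub>?A\<^esub>" unfolding eq by (simp add: pair_elem_0_right group_algebra_simps)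
  qed
qed

lemma pair_elem_surj:
  assumes a: "a \<in> carrier (group_algebra G :: ('g \<Rightarrow> 'b::field) ring)"
  obtains P Q where "a = pair_elem P Q"
proof -
  define poly_of where "poly_of = (\<lambda>c :: nat \<Rightarrow> 'b. \<Sum>i<n. Polynomial.monom (c i) i)"
  have co: "coeff (poly_of c) k = (if k < n then c k else 0)" for c k
    by (simp add: poly_of_def Polynomial.coeff_sum)
  have deg: "Polynomial.degree (poly_of c) < n" for c
    using degree_le[of "n - 1" "poly_of c"] n_pos co by fastforce
  let ?P = "poly_of (\<lambda>i. a (x [^] i))" and ?Q = "poly_of (\<lambda>i. a (x [^] i \<otimes> y))"
  have "a = pair_elem ?P ?Q"
  proof
    fix h
    show "a h = pair_elem ?P ?Q h"
    proof (cases "h \<in> carrier G")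
      case True
      then obtain i where "i < n" "h = x [^] i \<or> h = x [^] i \<otimes> y" using normal_form by blast
      thus ?thesis using pair_elem_coeff[OF deg deg, of i] by (auto simp: co)
    next
      case False
      thus ?thesis using group_algebra_outside[OF a] group_algebra_outside[OF pair_elem_closed] by metis
    qed
  qed
  thus thesis by (rule that)
qed

end

section \<open>Primitive central idempotents\<close>

text \<open>If \<open>e = u \<oplus> v\<close> splits an element of \<open>S\<close> orthogonally,
  then \<open>u \<otimes> e = u\<close>, and minimality forces \<open>u = e\<close>. Conversely, a
  primitive \<open>u\<close> is not annihilated by some \<open>e\<close> in \<open>S\<close>, so
  \<open>e \<otimes> u = e\<close>, and \<open>u\<close> would split as \<open>e\<close> plus
  \<open>u \<ominus> e\<close> unless the latter is zero.\<close>

lemma (in ring) primitive_central_idempotents_eq: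
  assumes S: "\<And>e. e \<in> S \<Longrightarrow> central_idempotent R e" "\<zero> \<notin> S"
    and minimal: "\<And>e u. e \<in> S \<Longrightarrow> central_idempotent R u \<Longrightarrow> u \<otimes> e = \<zero> \<or> u \<otimes> e = e"
    and cover: "\<And>u. central_idempotent R u \<Longrightarrow> u \<noteq> \<zero> \<Longrightarrow> \<exists>e\<in>S. e \<otimes> u \<noteq> \<zero>"
  shows "{e. primitive_central_idempotent R e} = S"
proof -
  have "primitive_central_idempotent R e" if e: "e \<in> S" for e
    unfolding primitive_central_idempotent_def
  proof (intro conjI notI)
    show "central_idempotent R e" using S e by blast
    show "e = \<zero> \<Longrightarrow> False" using S e by blast
    assume "\<exists>u v. central_idempotent R u \<and> central_idempotent R v \<and>
        u \<noteq> \<zero> \<and> v \<noteq> \<zero> \<and> u \<otimes> v = \<zero> \<and> e = u \<oplus> v"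
    then obtain u v where uv: "central_idempotent R u" "central_idempotent R v"
      "u \<noteq> \<zero>" "v \<noteq> \<zero>" "u \<otimes> v = \<zero>" "e = u \<oplus> v" by blast
    have c: "u \<in> carrier R" "v \<in> carrier R" "u \<otimes> u = u"
      using uv(1,2) unfolding central_idempotent_def by blast+
    have "u \<otimes> e = u" using c uv(5,6) by (simp add: r_distr)
    \<comment> \<open>As \<open>u \<otimes> e = u\<close> is nonzero, minimality leaves only
      \<open>u \<otimes> e = e\<close>.\<close>
    hence "u = u \<oplus> v" using minimal[OF e uv(1)] uv(3,6) by auto
    thus False using c uv(4) by (simp add: add.l_cancel_one')
  qed
  moreover have "u \<in> S" if u: "primitive_central_idempotent R u" for u
  proof -
    have ci: "central_idempotent R u" "u \<noteq> \<zero>" 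
      using u unfolding primitive_central_idempotent_def by blast+
    then obtain e where e: "e \<in> S" "e \<otimes> u \<noteq> \<zero>" using cover by blast
    have cie: "central_idempotent R e" "e \<noteq> \<zero>" using S e by blast+
    have c: "u \<in> carrier R" "e \<in> carrier R" "u \<otimes> u = u" "e \<otimes> e = e"
      and comm: "\<And>a. a \<in> carrier R \<Longrightarrow> a \<otimes> u = u \<otimes> a" "\<And>a. a \<in> carrier R \<Longrightarrow> a \<otimes> e = e \<otimes> a"
      using ci cie unfolding central_idempotent_def by blast+
    have eu: "e \<otimes> u = e" using minimal[OF e(1) ci(1)] e(2) comm(1)[OF c(2)] by simp
    hence ue: "u \<otimes> e = e" using comm(1)[OF c(2)] by simp
    define v where "v = u \<ominus> e"
    have v: "v \<in> carrier R" using c by (simp add: v_def)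
    have "v \<otimes> v = u \<ominus> e \<ominus> (e \<ominus> e)"
      using c ue eu by (simp add: v_def a_minus_def l_distr r_distr l_minus r_minus minus_add)
    hence "v \<otimes> v = v" using c by (simp add: v_def a_minus_def r_neg)
    moreover have "a \<otimes> v = v \<otimes> a" if "a \<in> carrier R" for a
      using that c comm[OF that] by (simp add: v_def a_minus_def l_distr r_distr l_minus r_minus)
    ultimately have civ: "central_idempotent R v" using v unfolding central_idempotent_def by blast
    have ev: "e \<otimes> v = \<zero>" using c eu by (simp add: v_def a_minus_def r_distr r_minus r_neg)
    have uev: "u = e \<oplus> v" using c by (simp add: v_def a_minus_def a_lcomm[of e u] r_neg)
    have "v = \<zero>"
      using u civ cie ev uev unfolding primitive_central_idempotent_def by blast
    hence "u = e" using uev c by simp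
    thus "u \<in> S" using e by simp
  qed
  ultimately show ?thesis by blast
qed

section \<open>Central idempotents in terms of \<open>P\<close> and \<open>Q\<close>\<close>

locale metacyclic_algebra = metacyclic_normal_form G x y n t + power_twist n t M
  for G :: "('g, 'm) monoid_scheme" (structure) and x y :: 'g and n t :: nat and M :: "'b::field poly" +
  assumes two: "(2::'b) \<noteq> 0"
begin

abbreviation A :: "('g \<Rightarrow> 'b) ring" where "A \<equiv> group_algebra G"

abbreviation half :: 'b where "half \<equiv> 1 / 2"

sublocale A: ring A
  by (rule ring_group_algebra) (rule is_group)

lemma pair_elem_mult':
  "pair_elem P Q \<otimes>\<^bsub>A\<^esub> pair_elem P' Q' = pair_elem (P * P' + Q * twist Q') (P * Q' + Q * twist P')"
  unfolding pair_elem_mult twist_def ..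

lemma pair_elem_zero_iff: "pair_elem P Q = \<zero>\<^bsub>A\<^esub> \<longleftrightarrow> M dvd P \<and> M dvd Q"
  unfolding pair_elem_eq_0_iff M_eq ..

lemma pair_elem_eq_iff: "pair_elem P Q = pair_elem P' Q' \<longleftrightarrow> M dvd P - P' \<and> M dvd Q - Q'"
proof -
  have "pair_elem P Q = pair_elem (P - P') (Q - Q') \<oplus>\<^bsub>A\<^esub> pair_elem P' Q'"
    by (simp add: pair_elem_add)
  hence "pair_elem P Q = pair_elem P' Q' \<longleftrightarrow> pair_elem (P - P') (Q - Q') = \<zero>\<^bsub>A\<^esub>"
    using A.add.r_cancel_one[OF pair_elem_closed pair_elem_closed] by metis
  thus ?thesis by (simp add: pair_elem_zero_iff)
qed

text \<open>Commuting with \<open>y\<close>, which is \<open>pair_elem 0 1\<close>, gives the two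
  invariance conditions, and commuting with \<open>x\<close> gives the condition on X^t - X. The
  last two conditions are the idempotent equation after invariance has removed the
  substitutions.\<close>

lemma central_idempotent_pair_elem_iff:
  "central_idempotent A (pair_elem P Q) \<longleftrightarrow>
    M dvd twist P - P \<and> M dvd twist Q - Q \<and> M dvd Q * (Polynomial.monom 1 t - [:0, 1:]) \<and>
    M dvd P * P + Q * Q - P \<and> M dvd P * Q + Q * P - Q" (is "?l \<longleftrightarrow> ?r")
proof -
  have id: "pair_elem P Q \<otimes>\<^bsub>A\<^esub> pair_elem P Q = pair_elem P Q \<longleftrightarrow>
      M dvd P * P + Q * Q - P \<and> M dvd P * Q + Q * P - Q"
    if "M dvd twist P - P" "M dvd twist Q - Q"
  proof -
    have "P * P + Q * twist Q - P = (P * P + Q * Q - P) + Q * (twist Q - Q)"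
      "P * Q + Q * twist P - Q = (P * Q + Q * P - Q) + Q * (twist P - P)"
      by (simp_all add: algebra_simps)
    thus ?thesis unfolding pair_elem_mult' pair_elem_eq_iff
      using that by (metis dvd_add_left_iff dvd_mult)
  qed
  show ?thesis
  proof
    assume l: ?l
    hence comm: "pair_elem P' Q' \<otimes>\<^bsub>A\<^esub> pair_elem P Q = pair_elem P Q \<otimes>\<^bsub>A\<^esub> pair_elem P' Q'" for P' Q'
      unfolding central_idempotent_def using pair_elem_closed by blast
    have "M dvd twist P - P" "M dvd twist Q - Q"
      using comm[of 0 1] by (simp_all add: pair_elem_mult' pair_elem_eq_iff)
    moreover have "M dvd [:0, 1:] * Q - Q * Polynomial.monom 1 t"
      using comm[of "[:0, 1:]" 0] unfolding pair_elem_mult' pair_elem_eq_iff twist_simps by simp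
    hence "M dvd - ([:0, 1:] * Q - Q * Polynomial.monom 1 t)" by (simp only: dvd_minus_iff)
    hence "M dvd Q * (Polynomial.monom 1 t - [:0, 1:])"
      by (simp only: right_diff_distrib minus_diff_eq mult.commute[of Q])
    moreover have "pair_elem P Q \<otimes>\<^bsub>A\<^esub> pair_elem P Q = pair_elem P Q"
      using l unfolding central_idempotent_def by blast
    ultimately show ?r using id by blast
  next
    assume r: ?r
    have "a \<otimes>\<^bsub>A\<^esub> pair_elem P Q = pair_elem P Q \<otimes>\<^bsub>A\<^esub> a" if a_in: "a \<in> carrier A" for a
    proof -
      obtain P' Q' where a: "a = pair_elem P' Q'" using pair_elem_surj[OF a_in] .
      \<comment> \<open>\<open>twist R - R\<close> is a multiple of X^t - X, whose product with
        \<open>Q\<close> vanishes modulo \<open>M\<close>.\<close>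
      have Q: "M dvd Q * (twist R - R)" for R
        using r twist_diff_dvd[of R] by (metis dvd_trans mult_dvd_mono dvd_refl)
      have "P' * P + Q' * twist Q - (P * P' + Q * twist Q') = Q' * (twist Q - Q) - Q * (twist Q' - Q')"
        "P' * Q + Q' * twist P - (P * Q' + Q * twist P') = Q' * (twist P - P) - Q * (twist P' - P')"
        by (simp_all add: algebra_simps)
      thus ?thesis unfolding a pair_elem_mult' pair_elem_eq_iff
        using r Q by (simp only:) (intro conjI dvd_diff[OF dvd_mult], auto)
    qed
    thus ?l unfolding central_idempotent_def using id r pair_elem_closed by blast
  qed
qed

lemma central_idempotent_is_pair_elem:
  assumes "central_idempotent A u"
  obtains P Q where "u = pair_elem P Q"
proof -
  have "u \<in> carrier A" using assms unfolding central_idempotent_def by blast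
  thus thesis by (rule pair_elem_surj) (rule that)
qed

lemma irr_dvd_of_M_dvd: "irr f \<Longrightarrow> M dvd P \<Longrightarrow> f dvd P"
  using irrD(3) dvd_trans by blast

lemma irr_dvd_twist_self:
  assumes "f dvd Polynomial.monom 1 t - [:0, 1:]"
  shows "f dvd twist f"
proof -
  have "f dvd twist f - f" using assms twist_diff_dvd dvd_trans by blast
  hence "f dvd (twist f - f) + f" by (intro dvd_add) auto
  thus ?thesis by simp
qed

lemma irr_dvd_idempotent: "irr f \<Longrightarrow> f dvd R * R - R \<Longrightarrow> f dvd R \<or> f dvd R - 1"
  using irr_dvd_mult[of f R "R - 1"] by (simp add: right_diff_distrib)

lemma e_poly_idem: "irr f \<Longrightarrow> M dvd e_poly n f * e_poly n f - e_poly n f"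
  using e_poly_dvd(3)[OF _ e_poly_dvd(1)] by (simp add: right_diff_distrib)

lemma e_poly_orthogonal: "irr f \<Longrightarrow> irr g \<Longrightarrow> f \<noteq> g \<Longrightarrow> M dvd e_poly n f * e_poly n g"
  by (rule e_poly_dvd(3)) (auto intro: e_poly_dvd(4))

text \<open>The parameter \<open>\<sigma>\<close> treats both signs of \<open>y\<close> at once. At
  \<open>f\<close>, where X^t and X agree, sending \<open>y\<close> to \<open>\<sigma>\<close> maps
  P + Q y to R = P + \<open>\<sigma>\<close> Q, and a central idempotent acts on \<open>e\<close> as
  multiplication by R, whose value at \<open>f\<close> is 0 or 1.\<close>

lemma split_idempotent:
  assumes f: "irr f" and fd: "f dvd Polynomial.monom 1 t - [:0, 1:]" and \<sigma>: "\<sigma> * \<sigma> = (1::'b)"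
  defines "e \<equiv> pair_elem (Polynomial.smult half (e_poly n f)) (Polynomial.smult (\<sigma> * half) (e_poly n f))"
  shows "(ga_single half \<one> \<oplus>\<^bsub>A\<^esub> ga_single (\<sigma> * half) y) \<otimes>\<^bsub>A\<^esub> ga_subst G x (e_poly n f) = e"
    and "central_idempotent A e" and "e \<noteq> \<zero>\<^bsub>A\<^esub>"
    and "\<And>u. central_idempotent A u \<Longrightarrow> u \<otimes>\<^bsub>A\<^esub> e = \<zero>\<^bsub>A\<^esub> \<or> u \<otimes>\<^bsub>A\<^esub> e = e"
    and "\<And>P Q. central_idempotent A (pair_elem P Q) \<Longrightarrow> e \<otimes>\<^bsub>A\<^esub> pair_elem P Q = \<zero>\<^bsub>A\<^esub>
      \<Longrightarrow> f dvd P + Polynomial.smult \<sigma> Q"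
proof -
  let ?E = "e_poly n f"
  have tw: "M dvd twist ?E - ?E" by (rule twist_e_poly[OF f f irr_dvd_twist_self[OF fd]])
  have h2: "half + half = 1" using two by (simp flip: add_divide_distrib)
  have ss: "\<sigma> * (\<sigma> * c) = c" for c using \<sigma> by (simp flip: mult.assoc)
  have "ga_single half \<one> \<oplus>\<^bsub>A\<^esub> ga_single (\<sigma> * half) y = pair_elem [:half:] [:\<sigma> * half:]"
    by (simp add: pair_elem_def ga_subst_const ga_single_mult)
  thus "(ga_single half \<one> \<oplus>\<^bsub>A\<^esub> ga_single (\<sigma> * half) y) \<otimes>\<^bsub>A\<^esub> ga_subst G x ?E = e"
    unfolding pair_elem_0_right[symmetric] e_def using tw
    by (simp add: pair_elem_mult' pair_elem_eq_iff dvd_smult flip: smult_diff_right)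
  \<comment> \<open>The scalar identities \<open>c1\<close> and \<open>c2\<close> express that (1 +
    \<open>\<sigma>\<close> y)/2 is idempotent.\<close>
  have "half * half + \<sigma> * half * (\<sigma> * half) = half * (half + half)"
    using ss[of "half * half"] by (simp only: mult.assoc mult.left_commute distrib_left)
  hence c1: "half * half + \<sigma> * half * (\<sigma> * half) = half" by (simp only: h2 mult_1_right)
  have c2: "half * (\<sigma> * half) + \<sigma> * half * half = \<sigma> * half"
    using h2 by (metis distrib_left mult.commute mult_1_right)
  show "central_idempotent A e" unfolding e_def central_idempotent_pair_elem_iff
  proof (intro conjI)
    have "Polynomial.smult half ?E * Polynomial.smult half ?E
        + Polynomial.smult (\<sigma> * half) ?E * Polynomial.smult (\<sigma> * half) ?E - Polynomial.smult half ?E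
        = Polynomial.smult half (?E * ?E - ?E)"
      unfolding mult_smult_left mult_smult_right smult_smult smult_add_left[symmetric] c1
      by (simp only: smult_diff_right)
    thus "M dvd Polynomial.smult half ?E * Polynomial.smult half ?E
        + Polynomial.smult (\<sigma> * half) ?E * Polynomial.smult (\<sigma> * half) ?E - Polynomial.smult half ?E"
      using e_poly_idem[OF f] by (simp only: dvd_smult)
    have "Polynomial.smult half ?E * Polynomial.smult (\<sigma> * half) ?E
        + Polynomial.smult (\<sigma> * half) ?E * Polynomial.smult half ?E - Polynomial.smult (\<sigma> * half) ?E
        = Polynomial.smult (\<sigma> * half) (?E * ?E - ?E)"
      unfolding mult_smult_left mult_smult_right smult_smult smult_add_left[symmetric]
      using c2 by (simp only: smult_diff_right mult.commute[of half "\<sigma> * half"])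
    thus "M dvd Polynomial.smult half ?E * Polynomial.smult (\<sigma> * half) ?E
        + Polynomial.smult (\<sigma> * half) ?E * Polynomial.smult half ?E - Polynomial.smult (\<sigma> * half) ?E"
      using e_poly_idem[OF f] by (simp only: dvd_smult)
    show "M dvd Polynomial.smult (\<sigma> * half) ?E * (Polynomial.monom 1 t - [:0, 1:])"
      using e_poly_dvd(3)[OF f fd] by (simp only: mult_smult_left dvd_smult)
  qed (use tw in \<open>simp_all only: twist_simps dvd_smult flip: smult_diff_right\<close>)
  show "e \<noteq> \<zero>\<^bsub>A\<^esub>"
  proof
    assume "e = \<zero>\<^bsub>A\<^esub>"
    hence "M dvd ?E" using two by (simp add: e_def pair_elem_zero_iff dvd_smult_iff)
    thus False using irr_dvd_of_M_dvd[OF f] e_poly_dvd(2)[OF f] by blast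
  qed
  show "u \<otimes>\<^bsub>A\<^esub> e = \<zero>\<^bsub>A\<^esub> \<or> u \<otimes>\<^bsub>A\<^esub> e = e" if u: "central_idempotent A u" for u
  proof -
    obtain P Q where PQ: "u = pair_elem P Q"
      using u by (rule central_idempotent_is_pair_elem)
    define R where "R = P + Polynomial.smult \<sigma> Q"
    \<comment> \<open>The two idempotent conditions combine, by
      \<open>\<sigma> * \<sigma> = 1\<close>, into R R - R.\<close>
    have "M dvd (P * P + Q * Q - P) + Polynomial.smult \<sigma> (P * Q + Q * P - Q)"
      using u unfolding PQ central_idempotent_pair_elem_iff by (intro dvd_add dvd_smult) auto
    also have "(P * P + Q * Q - P) + Polynomial.smult \<sigma> (P * Q + Q * P - Q) = R * R - R"
      using \<sigma> by (simp add: R_def algebra_simps smult_add_right smult_diff_right)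
    finally have "f dvd R \<or> f dvd R - 1" using irr_dvd_idempotent[OF f] irr_dvd_of_M_dvd[OF f] by blast
    \<comment> \<open>Identities \<open>1\<close> and \<open>2\<close>: up to multiples of
      \<open>twist ?E - ?E\<close>, the components of the product with \<open>e\<close> are those of
      \<open>e\<close> multiplied by \<open>R\<close>.\<close>
    have 1: "P * Polynomial.smult half ?E + Q * twist (Polynomial.smult (\<sigma> * half) ?E)
        = Polynomial.smult half (?E * R) + Polynomial.smult (\<sigma> * half) (Q * (twist ?E - ?E))"
      by (simp add: R_def algebra_simps smult_add_right smult_diff_right)
    have 2: "P * Polynomial.smult (\<sigma> * half) ?E + Q * twist (Polynomial.smult half ?E)
        = Polynomial.smult (\<sigma> * half) (?E * R) + Polynomial.smult half (Q * (twist ?E - ?E))"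
      using \<sigma> ss[of half] by (simp add: R_def algebra_simps smult_add_right smult_diff_right)
    have tw': "M dvd Polynomial.smult c (Q * (twist ?E - ?E))" for c
      using tw by (intro dvd_smult dvd_mult)
    show ?thesis
    proof (rule disjE[OF \<open>f dvd R \<or> f dvd R - 1\<close>])
      assume "f dvd R"
      hence "M dvd ?E * R" by (rule e_poly_dvd(3)[OF f])
      hence ER: "M dvd Polynomial.smult c (?E * R)" for c by (rule dvd_smult)
      have "u \<otimes>\<^bsub>A\<^esub> e = \<zero>\<^bsub>A\<^esub>"
        unfolding PQ e_def pair_elem_mult' pair_elem_zero_iff 1 2
        using tw' ER by (intro conjI dvd_add)
      thus ?thesis ..
    next
      assume "f dvd R - 1"
      hence "M dvd ?E * (R - 1)" by (rule e_poly_dvd(3)[OF f])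
      hence ER: "M dvd Polynomial.smult c (?E * (R - 1))" for c by (rule dvd_smult)
      have 3: "Polynomial.smult c (?E * R) + Z - Polynomial.smult c ?E
          = Polynomial.smult c (?E * (R - 1)) + Z" for c Z
        by (simp add: algebra_simps smult_diff_right)
      have "u \<otimes>\<^bsub>A\<^esub> e = e"
        unfolding PQ e_def pair_elem_mult' pair_elem_eq_iff 1 2 3
        using tw' ER by (intro conjI dvd_add)
      thus ?thesis ..
    qed
  qed
  show "f dvd P + Polynomial.smult \<sigma> Q"
    if u: "central_idempotent A (pair_elem P Q)" and 0: "e \<otimes>\<^bsub>A\<^esub> pair_elem P Q = \<zero>\<^bsub>A\<^esub>" for P Q
  proof -
    have Q: "M dvd twist Q - Q" using u by (simp add: central_idempotent_pair_elem_iff)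
    have "M dvd Polynomial.smult half ?E * P + Polynomial.smult (\<sigma> * half) ?E * twist Q"
      using 0 by (simp add: e_def pair_elem_mult' pair_elem_zero_iff)
    also have "Polynomial.smult half ?E * P + Polynomial.smult (\<sigma> * half) ?E * twist Q
        = Polynomial.smult half (?E * (P + Polynomial.smult \<sigma> (twist Q)))"
      by (simp add: algebra_simps smult_add_right)
    finally have "M dvd ?E * (P + Polynomial.smult \<sigma> (twist Q))" using two by (simp add: dvd_smult_iff)
    \<comment> \<open>\<open>f\<close> is prime and does not divide e_f; afterwards invariance
      replaces \<open>twist Q\<close> by \<open>Q\<close>.\<close>
    hence "f dvd P + Polynomial.smult \<sigma> (twist Q)"
      using irr_dvd_of_M_dvd[OF f] irr_dvd_mult[OF f] e_poly_dvd(2)[OF f] by blast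
    moreover have "f dvd Polynomial.smult \<sigma> (twist Q - Q)"
      using irr_dvd_of_M_dvd[OF f Q] by (rule dvd_smult)
    ultimately have "f dvd P + Polynomial.smult \<sigma> (twist Q) - Polynomial.smult \<sigma> (twist Q - Q)"
      by (rule dvd_diff)
    thus ?thesis by (simp add: smult_diff_right)
  qed
qed

text \<open>\<open>f\<close> divides \<open>Q\<close> times X^t - X and is prime, so
  \<open>Q\<close> vanishes at \<open>f\<close>. The idempotent equation then reads P^2 = P modulo
  \<open>f\<close>.\<close>

lemma central_idempotent_mod:
  assumes f: "irr f" and fd: "\<not> f dvd Polynomial.monom 1 t - [:0, 1:]"
    and u: "central_idempotent A (pair_elem P Q)"
  shows "f dvd Q" "f dvd P \<or> f dvd P - 1"
proof -
  note u' = u[unfolded central_idempotent_pair_elem_iff]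
  show Q: "f dvd Q"
    using u' irr_dvd_of_M_dvd[OF f] irr_dvd_mult[OF f] fd by blast
  have "f dvd P * P + Q * Q - P" using u' irr_dvd_of_M_dvd[OF f] by blast
  hence "f dvd P * P + Q * Q - P - Q * Q" using Q by (intro dvd_diff[of _ "P * P + Q * Q - P"]) auto
  hence "f dvd P * P - P" by (simp add: algebra_simps)
  thus "f dvd P \<or> f dvd P - 1" by (rule irr_dvd_idempotent[OF f])
qed

lemma pair_elem_left_nonzero:
  assumes f: "irr f" and a: "\<not> f dvd a" and PQ: "\<not> f dvd P \<or> \<not> f dvd Q"
  shows "pair_elem a 0 \<otimes>\<^bsub>A\<^esub> pair_elem P Q \<noteq> \<zero>\<^bsub>A\<^esub>"
proof
  assume "pair_elem a 0 \<otimes>\<^bsub>A\<^esub> pair_elem P Q = \<zero>\<^bsub>A\<^esub>"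
  hence "M dvd a * P" "M dvd a * Q" by (simp_all add: pair_elem_mult' pair_elem_zero_iff)
  hence "f dvd a * P" "f dvd a * Q" by (auto intro: irr_dvd_of_M_dvd[OF f])
  thus False using irr_dvd_mult[OF f] a PQ by blast
qed

text \<open>Invariance of \<open>a\<close> makes \<open>Q * twist a\<close> congruent to
  \<open>a * Q\<close>, hence to 0; what remains is \<open>P * a\<close>, which is 0 or
  \<open>a\<close>.\<close>

lemma pair_elem_minimal:
  assumes a: "M dvd twist a - a" and Q: "M dvd a * Q"
    and P: "M dvd a * P \<or> M dvd a * (P - 1)"
  shows "pair_elem P Q \<otimes>\<^bsub>A\<^esub> pair_elem a 0 = \<zero>\<^bsub>A\<^esub> \<or> pair_elem P Q \<otimes>\<^bsub>A\<^esub> pair_elem a 0 = pair_elem a 0"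
proof -
  have "Q * twist a = a * Q + Q * (twist a - a)" by (simp add: algebra_simps)
  hence "M dvd Q * twist a" using a Q by simp
  thus ?thesis using P
    by (auto simp: pair_elem_mult' pair_elem_zero_iff pair_elem_eq_iff algebra_simps)
qed

text \<open>\<open>f\<close> is its own partner, so e_f is invariant under the substitution;
  minimality comes from the values of \<open>P\<close> and \<open>Q\<close> at the single factor
  \<open>f\<close>.\<close>

lemma self_paired_idempotent:
  assumes f: "irr f" and fd: "\<not> f dvd Polynomial.monom 1 t - [:0, 1:]" and ff: "f dvd twist f"
  defines "e \<equiv> pair_elem (e_poly n f) 0"
  shows "central_idempotent A e" and "e \<noteq> \<zero>\<^bsub>A\<^esub>"
    and "\<And>u. central_idempotent A u \<Longrightarrow> u \<otimes>\<^bsub>A\<^esub> e = \<zero>\<^bsub>A\<^esub> \<or> u \<otimes>\<^bsub>A\<^esub> e = e"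
proof -
  have tw: "M dvd twist (e_poly n f) - e_poly n f" by (rule twist_e_poly[OF f f ff])
  show "central_idempotent A e" unfolding e_def central_idempotent_pair_elem_iff
    using tw e_poly_idem[OF f] by simp
  show "e \<noteq> \<zero>\<^bsub>A\<^esub>"
    using irr_dvd_of_M_dvd[OF f] e_poly_dvd(2)[OF f] by (auto simp: e_def pair_elem_zero_iff)
  fix u assume u: "central_idempotent A u"
  obtain P Q where PQ: "u = pair_elem P Q"
    using u by (rule central_idempotent_is_pair_elem)
  show "u \<otimes>\<^bsub>A\<^esub> e = \<zero>\<^bsub>A\<^esub> \<or> u \<otimes>\<^bsub>A\<^esub> e = e" unfolding PQ e_def
    using central_idempotent_mod[OF f fd u[unfolded PQ]] e_poly_dvd(3)[OF f]
    by (intro pair_elem_minimal[OF tw]) auto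
qed

text \<open>The substitution exchanges the two summands and fixes their sum. A central idempotent
  has invariant \<open>P\<close>, hence the same value 0 or 1 at \<open>f\<close> and
  \<open>g\<close>.\<close>

lemma paired_idempotent:
  assumes f: "irr f" and fd: "\<not> f dvd Polynomial.monom 1 t - [:0, 1:]"
    and g: "irr g" and gd: "\<not> g dvd Polynomial.monom 1 t - [:0, 1:]"
    and gf: "g dvd twist f" and neq: "f \<noteq> g"
  defines "a \<equiv> e_poly n f + e_poly n g"
  shows "\<not> f dvd a" and "central_idempotent A (pair_elem a 0)" and "pair_elem a 0 \<noteq> \<zero>\<^bsub>A\<^esub>"
    and "\<And>u. central_idempotent A u \<Longrightarrow>
      u \<otimes>\<^bsub>A\<^esub> pair_elem a 0 = \<zero>\<^bsub>A\<^esub> \<or> u \<otimes>\<^bsub>A\<^esub> pair_elem a 0 = pair_elem a 0"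
proof -
  let ?E = "e_poly n f" and ?F = "e_poly n g"
  have "M dvd (twist ?E - ?F) + (twist ?F - ?E)"
    using twist_e_poly[OF f g gf] twist_e_poly[OF g f dvd_twist_sym[OF f g gf]] by (rule dvd_add)
  hence tw: "M dvd twist a - a" by (simp add: a_def algebra_simps)
  have "a * a - a = (?E * ?E - ?E) + (?F * ?F - ?F) + (?E * ?F + ?E * ?F)"
    by (simp add: a_def algebra_simps)
  hence idem: "M dvd a * a - a"
    using e_poly_idem[OF f] e_poly_idem[OF g] e_poly_orthogonal[OF f g neq] by (simp only:) (intro dvd_add)
  show fa: "\<not> f dvd a"
    unfolding a_def using e_poly_dvd(2)[OF f] e_poly_dvd(4)[OF g f neq] by (simp add: dvd_add_left_iff)
  show "central_idempotent A (pair_elem a 0)" unfolding central_idempotent_pair_elem_iff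
    using tw idem by simp
  show "pair_elem a 0 \<noteq> \<zero>\<^bsub>A\<^esub>" using irr_dvd_of_M_dvd[OF f] fa by (auto simp: pair_elem_zero_iff)
  fix u assume u: "central_idempotent A u"
  obtain P Q where PQ: "u = pair_elem P Q"
    using u by (rule central_idempotent_is_pair_elem)
  note u' = u[unfolded PQ]
  have Ma: "M dvd a * R" if "f dvd R" "g dvd R" for R
    using that e_poly_dvd(3)[OF f] e_poly_dvd(3)[OF g] by (simp add: a_def distrib_right)
  \<comment> \<open>\<open>g\<close> divides \<open>twist f\<close> and so \<open>twist R\<close>;
    invariance leads back to \<open>R\<close>. Used for \<open>P\<close> and for
    \<open>P - 1\<close>.\<close>
  have move: "g dvd R" if "f dvd R" "M dvd twist R - R" for R
  proof -
    have "g dvd twist R" using gf twist_dvd[OF that(1)] dvd_trans by blast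
    hence "g dvd twist R - (twist R - R)" using irr_dvd_of_M_dvd[OF g that(2)] by (rule dvd_diff)
    thus ?thesis by simp
  qed
  have twP: "M dvd twist P - P" using u' by (simp add: central_idempotent_pair_elem_iff)
  show "u \<otimes>\<^bsub>A\<^esub> pair_elem a 0 = \<zero>\<^bsub>A\<^esub> \<or> u \<otimes>\<^bsub>A\<^esub> pair_elem a 0 = pair_elem a 0" unfolding PQ
  proof (rule pair_elem_minimal[OF tw])
    show "M dvd a * Q"
      using Ma central_idempotent_mod(1)[OF f fd u'] central_idempotent_mod(1)[OF g gd u'] by blast
    show "M dvd a * P \<or> M dvd a * (P - 1)"
      using central_idempotent_mod(2)[OF f fd u'] Ma move[of P] move[of "P - 1"] twP by auto
  qed
qed

section \<open>Assembling the complete list\<close>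

lemma primitive_central_idempotents:
  assumes s: "[int t = s] (mod int n)" and d: "d = gcd n (t - 1)"
  defines "E \<equiv> \<lambda>f. ga_subst G x (e_poly n f)"
  shows "{e. primitive_central_idempotent A e} =
      (\<Union>f \<in> {f. monic_irreducible_factor f (x_pow_minus_1 d)}.
         {(ga_single half \<one> \<oplus>\<^bsub>A\<^esub> ga_single half y) \<otimes>\<^bsub>A\<^esub> E f,
          (ga_single half \<one> \<oplus>\<^bsub>A\<^esub> ga_single (- half) y) \<otimes>\<^bsub>A\<^esub> E f})
    \<union> {E f | f. monic_irreducible_factor f (x_pow_minus_1 n div x_pow_minus_1 d)
              \<and> self_involutive s f}
    \<union> {E f \<oplus>\<^bsub>A\<^esub> E (star s f) | f.
          monic_irreducible_factor f (x_pow_minus_1 n div x_pow_minus_1 d)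
          \<and> monic_irreducible_factor (star s f) (x_pow_minus_1 n div x_pow_minus_1 d)
          \<and> f \<noteq> star s f}" (is "_ = ?S")
proof -
  define D where "D = (x_pow_minus_1 d :: 'b poly)"
  define W where "W = M div D"
  let ?T = "Polynomial.monom 1 t - [:0, 1:] :: 'b poly"
  let ?L = "\<lambda>f. (ga_single half \<one> \<oplus>\<^bsub>A\<^esub> ga_single half y) \<otimes>\<^bsub>A\<^esub> E f"
  let ?R = "\<lambda>f. (ga_single half \<one> \<oplus>\<^bsub>A\<^esub> ga_single (- half) y) \<otimes>\<^bsub>A\<^esub> E f"
  have "D dvd M" unfolding D_def M_eq by (rule x_pow_minus_1_dvd) (simp add: d)
  hence M: "M = D * W" by (simp add: W_def)
  have DT: "f dvd D \<longleftrightarrow> f dvd ?T" if "irr f" for f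
    unfolding D_def d by (rule dvd_x_pow_minus_1_iff[OF that])
  have irrD': "monic_irreducible_factor f D \<longleftrightarrow> irr f \<and> f dvd ?T" for f
    using DT[of f] by (auto simp: monic_irreducible_factor_def M)
  \<comment> \<open>As \<open>M = D * W\<close> is squarefree, each of its irreducible factors
    divides exactly one of \<open>D\<close> and \<open>W\<close>.\<close>
  have irrW: "monic_irreducible_factor f W \<longleftrightarrow> irr f \<and> \<not> f dvd ?T" for f
  proof -
    have "\<not> f dvd D \<longleftrightarrow> f dvd W" if f: "irr f"
    proof -
      obtain K where K: "M = f * K" "\<not> f dvd K" using irr_cofactor[OF f] .
      have "\<not> (f dvd D \<and> f dvd W)"
      proof
        assume "f dvd D \<and> f dvd W"
        then obtain a b where ab: "D = f * a" "W = f * b" by (auto elim!: dvdE)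
        have "f * K = f * (f * (a * b))" unfolding K(1)[symmetric] M ab by (simp only: ac_simps)
        hence "K = f * (a * b)" using irrD(1)[OF f] by auto
        thus False using K(2) by simp
      qed
      moreover have "f dvd D \<or> f dvd W" using irrD(3)[OF f] M irr_dvd_mult[OF f] by simp
      ultimately show ?thesis by blast
    qed
    thus ?thesis using DT[of f] by (auto simp: monic_irreducible_factor_def M)
  qed
  have S: "?S = (\<Union>f \<in> {f. irr f \<and> f dvd ?T}. {?L f, ?R f})
      \<union> {E f | f. (irr f \<and> \<not> f dvd ?T) \<and> self_involutive s f}
      \<union> {E f \<oplus>\<^bsub>A\<^esub> E (star s f) | f. (irr f \<and> \<not> f dvd ?T)
          \<and> (irr (star s f) \<and> \<not> star s f dvd ?T) \<and> f \<noteq> star s f}" (is "_ = ?S'")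
    unfolding M_eq[symmetric] D_def[symmetric] W_def[symmetric] irrD' irrW ..
  have E_sum: "E f \<oplus>\<^bsub>A\<^esub> E g = pair_elem (e_poly n f + e_poly n g) 0" for f g
    unfolding E_def pair_elem_0_right[symmetric] pair_elem_add by simp
  have E_pair: "E f = pair_elem (e_poly n f) 0" for f
    by (simp add: E_def pair_elem_0_right)
  have L: "?L f = (ga_single half \<one> \<oplus>\<^bsub>A\<^esub> ga_single (1 * half) y) \<otimes>\<^bsub>A\<^esub> ga_subst G x (e_poly n f)"
    and R: "?R f = (ga_single half \<one> \<oplus>\<^bsub>A\<^esub> ga_single (-1 * half) y) \<otimes>\<^bsub>A\<^esub> ga_subst G x (e_poly n f)" for f
    by (simp_all add: E_def)
  have good: "central_idempotent A e \<and> e \<noteq> \<zero>\<^bsub>A\<^esub> \<and>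
      (\<forall>u. central_idempotent A u \<longrightarrow> u \<otimes>\<^bsub>A\<^esub> e = \<zero>\<^bsub>A\<^esub> \<or> u \<otimes>\<^bsub>A\<^esub> e = e)" (is "?good e") if "e \<in> ?S'" for e
    using that
  proof (elim UnE)
    assume "e \<in> (\<Union>f \<in> {f. irr f \<and> f dvd ?T}. {?L f, ?R f})"
    then obtain f where f: "irr f" "f dvd ?T" and e: "e = ?L f \<or> e = ?R f" by blast
    have "?good ((ga_single half \<one> \<oplus>\<^bsub>A\<^esub> ga_single (\<sigma> * half) y) \<otimes>\<^bsub>A\<^esub> ga_subst G x (e_poly n f))"
      if "\<sigma> * \<sigma> = 1" for \<sigma>
      unfolding split_idempotent(1)[OF f that] using split_idempotent(2-4)[OF f that] by blast
    from this[of 1] this[of "-1"] show ?thesis using e unfolding L R by auto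
  next
    assume "e \<in> {E f | f. (irr f \<and> \<not> f dvd ?T) \<and> self_involutive s f}"
    then obtain f where f: "irr f" "\<not> f dvd ?T" "self_involutive s f" "e = E f" by blast
    obtain g where g: "irr g" "g dvd twist f" using dvd_twist_exists[OF f(1)] .
    have "f = g" using star_eq(3)[OF s f(1) g] f(3) by simp
    thus ?thesis unfolding f(4) E_pair using self_paired_idempotent[OF f(1,2)] g(2) by blast
  next
    assume "e \<in> {E f \<oplus>\<^bsub>A\<^esub> E (star s f) | f. (irr f \<and> \<not> f dvd ?T)
          \<and> (irr (star s f) \<and> \<not> star s f dvd ?T) \<and> f \<noteq> star s f}"
    then obtain f where f: "irr f" "\<not> f dvd ?T" "irr (star s f)" "\<not> star s f dvd ?T"
      "f \<noteq> star s f" and e: "e = E f \<oplus>\<^bsub>A\<^esub> E (star s f)" by blast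
    obtain g where g: "irr g" "g dvd twist f" using dvd_twist_exists[OF f(1)] .
    have "star s f = g" using star_eq(2)[OF s f(1) g] .
    thus ?thesis unfolding e E_sum using paired_idempotent(2-4)[OF f(1-4) _ f(5)] g(2) by blast
  qed
  \<comment> \<open>A nonzero \<open>u\<close> is nonzero at some irreducible factor
    \<open>f\<close>, and a listed element belonging to \<open>f\<close> does not annihilate
    it.\<close>
  have cover: "\<exists>e\<in>?S'. e \<otimes>\<^bsub>A\<^esub> u \<noteq> \<zero>\<^bsub>A\<^esub>" if u: "central_idempotent A u" "u \<noteq> \<zero>\<^bsub>A\<^esub>" for u
  proof -
    obtain P Q where PQ: "u = pair_elem P Q" using u(1) by (rule central_idempotent_is_pair_elem)
    have "\<not> (M dvd P \<and> M dvd Q)" using u(2) unfolding PQ pair_elem_zero_iff .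
    then obtain f where f: "irr f" "\<not> f dvd P \<or> \<not> f dvd Q"
      using M_dvd_if[of P] M_dvd_if[of Q] by blast
    show ?thesis
    proof (cases "f dvd ?T")
      case True
      \<comment> \<open>Annihilation by both elements would make \<open>f\<close> divide P + Q and P
        - Q, hence 2 P and 2 Q, where 2 is invertible.\<close>
      have "?L f \<otimes>\<^bsub>A\<^esub> u \<noteq> \<zero>\<^bsub>A\<^esub> \<or> ?R f \<otimes>\<^bsub>A\<^esub> u \<noteq> \<zero>\<^bsub>A\<^esub>"
      proof (rule ccontr)
        assume "\<not> ?thesis"
        hence 0: "?L f \<otimes>\<^bsub>A\<^esub> u = \<zero>\<^bsub>A\<^esub>" "?R f \<otimes>\<^bsub>A\<^esub> u = \<zero>\<^bsub>A\<^esub>" by blast+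
        have dvd: "f dvd P + Polynomial.smult \<sigma> Q" if \<sigma>: "\<sigma> * \<sigma> = 1"
          and "(ga_single half \<one> \<oplus>\<^bsub>A\<^esub> ga_single (\<sigma> * half) y) \<otimes>\<^bsub>A\<^esub> ga_subst G x (e_poly n f) \<otimes>\<^bsub>A\<^esub> u = \<zero>\<^bsub>A\<^esub>"
        for \<sigma>
          using that(2) unfolding split_idempotent(1)[OF f(1) True \<sigma>] PQ
          by (rule split_idempotent(5)[OF f(1) True \<sigma> u(1)[unfolded PQ]])
        have plus: "f dvd P + Q" and minus: "f dvd P - Q"
          using dvd[OF _ 0(1)[unfolded L]] dvd[OF _ 0(2)[unfolded R]] by simp_all
        have smult_2: "Polynomial.smult 2 R = R + R" for R :: "'b poly"
          by (metis one_add_one smult_1_left smult_add_left)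
        have "f dvd (P + Q) + (P - Q)" "f dvd (P + Q) - (P - Q)"
          by (rule dvd_add[OF plus minus], rule dvd_diff[OF plus minus])
        hence "f dvd Polynomial.smult 2 P" "f dvd Polynomial.smult 2 Q"
          by (simp_all add: smult_2)
        hence "f dvd P" "f dvd Q" using two by (simp_all add: dvd_smult_iff)
        thus False using f(2) by blast
      qed
      thus ?thesis using f(1) True by blast
    next
      case False
      obtain g where g: "irr g" "g dvd twist f" using dvd_twist_exists[OF f(1)] .
      note st = star_eq[OF s f(1) g]
      show ?thesis
      proof (cases "f = g")
        case True
        hence "E f \<in> ?S'" using f(1) False st(3) by blast
        moreover have "E f \<otimes>\<^bsub>A\<^esub> u \<noteq> \<zero>\<^bsub>A\<^esub>"
          unfolding E_pair PQ by (rule pair_elem_left_nonzero[OF f(1) e_poly_dvd(2)[OF f(1)] f(2)])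
        ultimately show ?thesis by blast
      next
        case neq: False
        \<comment> \<open>If \<open>g\<close> divided X^t - X, it would be its own partner; but
          \<open>f\<close> is a partner of \<open>g\<close> as well, so uniqueness would give
          \<open>f = g\<close>.\<close>
        have gT: "\<not> g dvd ?T"
          using dvd_twist_unique[OF g(1) f(1) g(1) dvd_twist_sym[OF f(1) g]] irr_dvd_twist_self neq by blast
        have "E f \<oplus>\<^bsub>A\<^esub> E (star s f) \<in> ?S'" using f(1) False g(1) gT neq st(2) by blast
        moreover have "(E f \<oplus>\<^bsub>A\<^esub> E (star s f)) \<otimes>\<^bsub>A\<^esub> u \<noteq> \<zero>\<^bsub>A\<^esub>"
          unfolding E_sum PQ st(2)
          by (rule pair_elem_left_nonzero[OF f(1) paired_idempotent(1)[OF f(1) False g(1) gT g(2) neq] f(2)])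
        ultimately show ?thesis by blast
      qed
    qed
  qed
  show ?thesis unfolding S
  proof (rule A.primitive_central_idempotents_eq)
    show "\<zero>\<^bsub>A\<^esub> \<notin> ?S'"
    proof
      assume "\<zero>\<^bsub>A\<^esub> \<in> ?S'"
      from good[OF this] show False by blast
    qed
  next
    fix e assume "e \<in> ?S'"
    from good[OF this] show "central_idempotent A e" ..
  next
    fix e u assume "e \<in> ?S'" and u: "central_idempotent A u"
    from good[OF this(1)] u show "u \<otimes>\<^bsub>A\<^esub> e = \<zero>\<^bsub>A\<^esub> \<or> u \<otimes>\<^bsub>A\<^esub> e = e" by blast
  qed (rule cover)
qed

end

section \<open>From the presented group over a finite field to the setting above\<close>

theorem theorem5p3:
  fixes n d q :: nat and s :: int
    and G :: "gen word set monoid" and x y :: "gen word set"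
    and A :: "(gen word set \<Rightarrow> 'a::{field, finite}) ring"
    and E :: "'a poly \<Rightarrow> gen word set \<Rightarrow> 'a"
  assumes q: "q = CARD('a)"
    and s: "[s\<^sup>2 = 1] (mod int n)"
    and coprime: "gcd (2 * n) q = 1"
    and d: "int d = gcd (int n) (s - 1)"
    and G: "G = metacyclic_group n s"
    and x: "x = metacyclic_gen n s Gen_x"
    and y: "y = metacyclic_gen n s Gen_y"
    and A: "A = group_algebra G"
    and E: "\<And>f. E f = ga_subst G x (e_poly n f)"
  shows "{e. primitive_central_idempotent A e} =
      (\<Union>f \<in> {f. monic_irreducible_factor f (x_pow_minus_1 d)}.
         {(ga_single (1/2) \<one>\<^bsub>G\<^esub> \<oplus>\<^bsub>A\<^esub> ga_single (1/2) y) \<otimes>\<^bsub>A\<^esub> E f,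
          (ga_single (1/2) \<one>\<^bsub>G\<^esub> \<oplus>\<^bsub>A\<^esub> ga_single (- (1/2)) y) \<otimes>\<^bsub>A\<^esub> E f})
    \<union> {E f | f. monic_irreducible_factor f (x_pow_minus_1 n div x_pow_minus_1 d)
              \<and> self_involutive s f}
    \<union> {E f \<oplus>\<^bsub>A\<^esub> E (star s f) | f.
          monic_irreducible_factor f (x_pow_minus_1 n div x_pow_minus_1 d)
          \<and> monic_irreducible_factor (star s f) (x_pow_minus_1 n div x_pow_minus_1 d)
          \<and> f \<noteq> star s f}"
proof -
  have "coprime (2 * n) q" using coprime by (simp only: coprime_iff_gcd_eq_1)
  \<comment> \<open>The characteristic divides \<open>q\<close> and is not 1, so coprimality keeps
    it from dividing \<open>2 * n\<close>.\<close>
  hence "\<not> CHAR('a) dvd 2 * n"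
    using CHAR_dvd_CARD[where 'a = 'a] CHAR_not_1[where 'a = 'a] unfolding q
    by (metis coprime_common_divisor_nat nat_dvd_1_iff_1 One_nat_def)
  hence "of_nat (2 * n) \<noteq> (0::'a)" using of_nat_eq_0_iff_char_dvd by blast
  hence two: "(2::'a) \<noteq> 0" and n: "of_nat n \<noteq> (0::'a)" by auto
  hence n_pos: "n > 0" by (cases n) auto
  \<comment> \<open>The summand \<open>n\<close> keeps \<open>t\<close> positive also for
    \<open>n = 1\<close>, where \<open>s mod int n\<close> is 0.\<close>
  define t where "t = nat (s mod int n) + n"
  have "int t = s mod int n + int n" using n_pos by (simp add: t_def)
  hence t: "[int t = s] (mod int n)" by (simp add: cong_def)
  have "[int t * int t = s\<^sup>2] (mod int n)" unfolding power2_eq_square by (rule cong_mult[OF t t])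
  hence "[int (t * t) = int 1] (mod int n)" using s by (metis cong_trans of_nat_mult of_nat_1)
  hence tt: "[t * t = 1] (mod n)" by (simp only: cong_int_iff)
  have t_pos: "t > 0" using n_pos by (simp add: t_def)
  \<comment> \<open>The gcd with \<open>n\<close> depends only on \<open>t - 1\<close> modulo
    \<open>n\<close>, and \<open>t_pos\<close> makes the natural subtraction exact.\<close>
  have "int (gcd n (t - 1)) = gcd (int t - 1) (int n)"
    using t_pos by (simp add: gcd.commute of_nat_diff flip: gcd_int_int_eq)
  also have "\<dots> = gcd (s - 1) (int n)" by (rule cong_gcd_eq[OF cong_diff[OF t cong_refl]])
  finally have d': "d = gcd n (t - 1)" using d by (simp add: gcd.commute)
  interpret N: metacyclic_normal_form G x y n t
    unfolding G x y by (rule metacyclic_normal_form_metacyclic_group[OF n_pos s t])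
  interpret metacyclic_algebra G x y n t "x_pow_minus_1 n :: 'a poly"
    by unfold_locales (use n t_pos tt two in auto)
  show ?thesis unfolding A E by (rule primitive_central_idempotents[OF t d'])
qed

end
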